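(* There is a formula $\varphi$ in the language of $\mathsf{E\text{-}PA}^{\omega}$ with exactly two free variables $x^0$ and $y^0$ such that $$\mathsf{E\text{-}PA}^{\omega} \not\vdash\ \forall x^{0}\,\exists y^{0}\,\varphi(x,y) \to \exists f^{1}\,\forall x^{0}\,\exists y\in f(x)\ \varphi(x,y).$$
   Context: $\mathsf{E\text{-}PA}^{\omega}$ is classical extensional Peano arithmetic in all finite types (as in Kohlenbach's "Applied Proof Theory"; called $\mathsf{E\text{-}PA}^\omega_0$ in Troelstra 1973 and $\mathsf{E\text{-}PA}^\omega_\to$ in Troelstra–van Dalen), i.e. the theory in many-sorted classical logic with constants for zero, successor, the combinators $\Pi$ and $\Sigma$, and the (simultaneous) primitive recursors in all finite types (so that its closed terms are those of Gödel's $T$), with the equality axioms for type $0$, the successor axioms, and the defining equations of these constants: finite types are generated from the base type $0$ (natural numbers) by $\to$ (no product types), only equality at type $0$ is primitive, equality at higher types is defined extensionally, and the axiom of extensionality and full induction for formulas of the language are included. Type $1$ is $0\to 0$; superscripts on variables denote types. Finite sequences of natural numbers are coded as natural numbers in such a way that every number codes a finite sequence; $y\in f(x)$ means that $y$ equals one of the components of the finite sequence coded by $f(x)$. *)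

theory Defs
  imports Main
begin

section \<open>The language of \<open>E-PA\<^sup>\<omega>\<close>\<close>

datatype ty = TNat | TFun ty ty  (infixr "\<Rrightarrow>" 70)

abbreviation arrows :: "ty list \<Rightarrow> ty \<Rightarrow> ty" where
  "arrows \<rho>s \<tau> \<equiv> foldr TFun \<rho>s \<tau>"

text \<open>Variables are named and carry their type, so there are infinitely many of each type.\<close>

type_synonym var = "nat \<times> ty"

text \<open>
  Raw applicative terms; typing is imposed by \<open>type_of\<close> below.
  \<open>CRec \<rho>s i\<close> is the \<open>i\<close>-th (counting from 0) of the simultaneous primitive recursors for the
  nonempty tuple of types \<open>\<rho>s\<close>.
\<close>

datatype trm =
    Var var
  | CZero
  | CSuc
  | CPi ty ty
  | CSigma ty ty ty
  | CRec "ty list" nat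
  | App trm trm  (infixl "\<cdot>" 80)

abbreviation apps :: "trm \<Rightarrow> trm list \<Rightarrow> trm" where
  "apps t ts \<equiv> foldl App t ts"

fun type_of :: "trm \<Rightarrow> ty option" where
  "type_of (Var v) = Some (snd v)"
| "type_of CZero = Some TNat"
| "type_of CSuc = Some (TNat \<Rrightarrow> TNat)"
| "type_of (CPi \<rho> \<tau>) = Some (\<rho> \<Rrightarrow> \<tau> \<Rrightarrow> \<rho>)"
| "type_of (CSigma \<delta> \<rho> \<tau>) = Some ((\<delta> \<Rrightarrow> \<rho> \<Rrightarrow> \<tau>) \<Rrightarrow> (\<delta> \<Rrightarrow> \<rho>) \<Rrightarrow> \<delta> \<Rrightarrow> \<tau>)"
| "type_of (CRec \<rho>s i) =
     (if i < length \<rho>s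
      then Some (TNat \<Rrightarrow> arrows \<rho>s (arrows (map (\<lambda>\<rho>. arrows \<rho>s (TNat \<Rrightarrow> \<rho>)) \<rho>s) (\<rho>s ! i)))
      else None)"
| "type_of (s \<cdot> t) =
     (case (type_of s, type_of t) of
        (Some (\<rho> \<Rrightarrow> \<tau>), Some \<rho>') \<Rightarrow> if \<rho> = \<rho>' then Some \<tau> else None
      | _ \<Rightarrow> None)"

definition has_type :: "trm \<Rightarrow> ty \<Rightarrow> bool" where
  "has_type t \<sigma> \<longleftrightarrow> type_of t = Some \<sigma>"

primrec fv_trm :: "trm \<Rightarrow> var set" where
  "fv_trm (Var v) = {v}"
| "fv_trm CZero = {}"
| "fv_trm CSuc = {}"
| "fv_trm (CPi \<rho> \<tau>) = {}"
| "fv_trm (CSigma \<delta> \<rho> \<tau>) = {}"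
| "fv_trm (CRec \<rho>s i) = {}"
| "fv_trm (s \<cdot> t) = fv_trm s \<union> fv_trm t"

primrec subst_trm :: "trm \<Rightarrow> var \<Rightarrow> trm \<Rightarrow> trm" where
  "subst_trm (Var w) v u = (if w = v then u else Var w)"
| "subst_trm CZero v u = CZero"
| "subst_trm CSuc v u = CSuc"
| "subst_trm (CPi \<rho> \<tau>) v u = CPi \<rho> \<tau>"
| "subst_trm (CSigma \<delta> \<rho> \<tau>) v u = CSigma \<delta> \<rho> \<tau>"
| "subst_trm (CRec \<rho>s i) v u = CRec \<rho>s i"
| "subst_trm (s \<cdot> t) v u = subst_trm s v u \<cdot> subst_trm t v u"

text \<open>The only atomic formulas besides falsity are equations between terms of type 0.\<close>

datatype fm =
    Eq trm trm
  | Falsum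
  | Conj fm fm
  | Disj fm fm
  | Imp fm fm
  | Forall var fm
  | Exists var fm

abbreviation Neg :: "fm \<Rightarrow> fm" where
  "Neg A \<equiv> Imp A Falsum"

primrec wf_fm :: "fm \<Rightarrow> bool" where
  "wf_fm (Eq s t) \<longleftrightarrow> has_type s TNat \<and> has_type t TNat"
| "wf_fm Falsum \<longleftrightarrow> True"
| "wf_fm (Conj A B) \<longleftrightarrow> wf_fm A \<and> wf_fm B"
| "wf_fm (Disj A B) \<longleftrightarrow> wf_fm A \<and> wf_fm B"
| "wf_fm (Imp A B) \<longleftrightarrow> wf_fm A \<and> wf_fm B"
| "wf_fm (Forall v A) \<longleftrightarrow> wf_fm A"
| "wf_fm (Exists v A) \<longleftrightarrow> wf_fm A"

primrec fv_fm :: "fm \<Rightarrow> var set" where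
  "fv_fm (Eq s t) = fv_trm s \<union> fv_trm t"
| "fv_fm Falsum = {}"
| "fv_fm (Conj A B) = fv_fm A \<union> fv_fm B"
| "fv_fm (Disj A B) = fv_fm A \<union> fv_fm B"
| "fv_fm (Imp A B) = fv_fm A \<union> fv_fm B"
| "fv_fm (Forall v A) = fv_fm A - {v}"
| "fv_fm (Exists v A) = fv_fm A - {v}"

text \<open>
  Substitution for free occurrences does not rename bound variables; it is used only under
  the side condition \<open>free_for\<close>, which excludes capture.
\<close>

primrec subst_fm :: "fm \<Rightarrow> var \<Rightarrow> trm \<Rightarrow> fm" where
  "subst_fm (Eq s t) v u = Eq (subst_trm s v u) (subst_trm t v u)"
| "subst_fm Falsum v u = Falsum"
| "subst_fm (Conj A B) v u = Conj (subst_fm A v u) (subst_fm B v u)"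
| "subst_fm (Disj A B) v u = Disj (subst_fm A v u) (subst_fm B v u)"
| "subst_fm (Imp A B) v u = Imp (subst_fm A v u) (subst_fm B v u)"
| "subst_fm (Forall w A) v u = (if w = v then Forall w A else Forall w (subst_fm A v u))"
| "subst_fm (Exists w A) v u = (if w = v then Exists w A else Exists w (subst_fm A v u))"

primrec free_for :: "trm \<Rightarrow> var \<Rightarrow> fm \<Rightarrow> bool" where
  "free_for u v (Eq s t) \<longleftrightarrow> True"
| "free_for u v Falsum \<longleftrightarrow> True"
| "free_for u v (Conj A B) \<longleftrightarrow> free_for u v A \<and> free_for u v B"
| "free_for u v (Disj A B) \<longleftrightarrow> free_for u v A \<and> free_for u v B"
| "free_for u v (Imp A B) \<longleftrightarrow> free_for u v A \<and> free_for u v B"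
| "free_for u v (Forall w A) \<longleftrightarrow> v \<notin> fv_fm (Forall w A) \<or> (w \<notin> fv_trm u \<and> free_for u v A)"
| "free_for u v (Exists w A) \<longleftrightarrow> v \<notin> fv_fm (Exists w A) \<or> (w \<notin> fv_trm u \<and> free_for u v A)"

definition fresh :: "var set \<Rightarrow> ty \<Rightarrow> var" where
  "fresh V \<sigma> = (LEAST n. n \<notin> fst ` V, \<sigma>)"

text \<open>Extensional equality at type \<open>\<sigma>\<close>, an abbreviation for a formula of the language.\<close>

fun EqAt :: "ty \<Rightarrow> trm \<Rightarrow> trm \<Rightarrow> fm" where
  "EqAt TNat s t = Eq s t"
| "EqAt (\<rho> \<Rrightarrow> \<tau>) s t =
     (let v = fresh (fv_trm s \<union> fv_trm t) \<rho> in Forall v (EqAt \<tau> (s \<cdot> Var v) (t \<cdot> Var v)))"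


section \<open>Derivability in \<open>E-PA\<^sup>\<omega>\<close>\<close>

text \<open>
  A Hilbert calculus for many-sorted classical predicate logic together with the axioms of
  \<open>E-PA\<^sup>\<omega>\<close>. Only well-formed formulas are derivable. Congruence of \<open>=\<^sub>0\<close> with respect to all terms is
  an instance of extensionality.
\<close>

inductive EPA :: "fm \<Rightarrow> bool" where
  MP: "EPA A \<Longrightarrow> EPA (Imp A B) \<Longrightarrow> EPA B"
| K: "wf_fm A \<Longrightarrow> wf_fm B \<Longrightarrow> EPA (Imp A (Imp B A))"
| S: "wf_fm A \<Longrightarrow> wf_fm B \<Longrightarrow> wf_fm C \<Longrightarrow>
      EPA (Imp (Imp A (Imp B C)) (Imp (Imp A B) (Imp A C)))"
| conjI: "wf_fm A \<Longrightarrow> wf_fm B \<Longrightarrow> EPA (Imp A (Imp B (Conj A B)))"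
| conjE1: "wf_fm A \<Longrightarrow> wf_fm B \<Longrightarrow> EPA (Imp (Conj A B) A)"
| conjE2: "wf_fm A \<Longrightarrow> wf_fm B \<Longrightarrow> EPA (Imp (Conj A B) B)"
| disjI1: "wf_fm A \<Longrightarrow> wf_fm B \<Longrightarrow> EPA (Imp A (Disj A B))"
| disjI2: "wf_fm A \<Longrightarrow> wf_fm B \<Longrightarrow> EPA (Imp B (Disj A B))"
| disjE: "wf_fm A \<Longrightarrow> wf_fm B \<Longrightarrow> wf_fm C \<Longrightarrow>
      EPA (Imp (Imp A C) (Imp (Imp B C) (Imp (Disj A B) C)))"
| falsumE: "wf_fm A \<Longrightarrow> EPA (Imp Falsum A)"
| lem: "wf_fm A \<Longrightarrow> EPA (Disj A (Neg A))"
| forallE: "wf_fm A \<Longrightarrow> has_type t (snd v) \<Longrightarrow> free_for t v A \<Longrightarrow>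
      EPA (Imp (Forall v A) (subst_fm A v t))"
| existsI: "wf_fm A \<Longrightarrow> has_type t (snd v) \<Longrightarrow> free_for t v A \<Longrightarrow>
      EPA (Imp (subst_fm A v t) (Exists v A))"
| forallI: "EPA (Imp B A) \<Longrightarrow> v \<notin> fv_fm B \<Longrightarrow> EPA (Imp B (Forall v A))"
| existsE: "EPA (Imp A B) \<Longrightarrow> v \<notin> fv_fm B \<Longrightarrow> EPA (Imp (Exists v A) B)"
| eq_refl: "has_type s TNat \<Longrightarrow> EPA (Eq s s)"
| eq_sym: "has_type s TNat \<Longrightarrow> has_type t TNat \<Longrightarrow> EPA (Imp (Eq s t) (Eq t s))"
| eq_trans: "has_type s TNat \<Longrightarrow> has_type t TNat \<Longrightarrow> has_type u TNat \<Longrightarrow>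
      EPA (Imp (Eq s t) (Imp (Eq t u) (Eq s u)))"
| extensionality: "has_type z (\<rho> \<Rrightarrow> \<tau>) \<Longrightarrow> has_type s \<rho> \<Longrightarrow> has_type t \<rho> \<Longrightarrow>
      EPA (Imp (EqAt \<rho> s t) (EqAt \<tau> (z \<cdot> s) (z \<cdot> t)))"
| suc_nonzero: "has_type s TNat \<Longrightarrow> EPA (Neg (Eq (CSuc \<cdot> s) CZero))"
| suc_inject: "has_type s TNat \<Longrightarrow> has_type t TNat \<Longrightarrow>
      EPA (Imp (Eq (CSuc \<cdot> s) (CSuc \<cdot> t)) (Eq s t))"
| induction: "wf_fm A \<Longrightarrow> snd v = TNat \<Longrightarrow>
      EPA (Imp (Conj (subst_fm A v CZero) (Forall v (Imp A (subst_fm A v (CSuc \<cdot> Var v)))))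
               (Forall v A))"
| Pi_eq: "has_type s \<rho> \<Longrightarrow> has_type t \<tau> \<Longrightarrow> EPA (EqAt \<rho> (CPi \<rho> \<tau> \<cdot> s \<cdot> t) s)"
| Sigma_eq: "has_type s (\<delta> \<Rrightarrow> \<rho> \<Rrightarrow> \<tau>) \<Longrightarrow> has_type t (\<delta> \<Rrightarrow> \<rho>) \<Longrightarrow> has_type u \<delta> \<Longrightarrow>
      EPA (EqAt \<tau> (CSigma \<delta> \<rho> \<tau> \<cdot> s \<cdot> t \<cdot> u) (s \<cdot> u \<cdot> (t \<cdot> u)))"
| Rec_zero: "i < length \<rho>s \<Longrightarrow> list_all2 has_type ys \<rho>s \<Longrightarrow>
      list_all2 has_type zs (map (\<lambda>\<rho>. arrows \<rho>s (TNat \<Rrightarrow> \<rho>)) \<rho>s) \<Longrightarrow>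
      EPA (EqAt (\<rho>s ! i) (apps (CRec \<rho>s i) (CZero # ys @ zs)) (ys ! i))"
| Rec_suc: "i < length \<rho>s \<Longrightarrow> has_type x TNat \<Longrightarrow> list_all2 has_type ys \<rho>s \<Longrightarrow>
      list_all2 has_type zs (map (\<lambda>\<rho>. arrows \<rho>s (TNat \<Rrightarrow> \<rho>)) \<rho>s) \<Longrightarrow>
      EPA (EqAt (\<rho>s ! i) (apps (CRec \<rho>s i) ((CSuc \<cdot> x) # ys @ zs))
             (apps (zs ! i) (map (\<lambda>j. apps (CRec \<rho>s j) (x # ys @ zs)) [0..<length \<rho>s] @ [x])))"


section \<open>Coded finite sequences\<close>

text \<open>
  The sequence coding is the bijection between numbers and finite sequences in which 0 codes the
  empty sequence and \<open>Suc (j a c)\<close> codes the sequence with first component \<open>a\<close> followed by the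
  sequence coded by \<open>c\<close>, where \<open>j a b = (a + b) * (a + b + 1) div 2 + a\<close> is the Cantor pairing.
  The decoding functions are closed terms, built by combinatory abstraction \<open>Lam v t\<close>
  (for well-typed \<open>t\<close>).
\<close>

fun Lam :: "var \<Rightarrow> trm \<Rightarrow> trm" where
  "Lam v (s \<cdot> t) =
     (if v \<in> fv_trm (s \<cdot> t)
      then CSigma (snd v) (the (type_of t)) (the (type_of (s \<cdot> t))) \<cdot> Lam v s \<cdot> Lam v t
      else CPi (the (type_of (s \<cdot> t))) (snd v) \<cdot> (s \<cdot> t))"
| "Lam v t =
     (if t = Var v
      then CSigma (snd v) (snd v \<Rrightarrow> snd v) (snd v) \<cdot> CPi (snd v) (snd v \<Rrightarrow> snd v)
             \<cdot> CPi (snd v) (snd v)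
      else CPi (the (type_of t)) (snd v) \<cdot> t)"

abbreviation (input) nv :: "nat \<Rightarrow> var" where
  "nv n \<equiv> (n, TNat)"

abbreviation Lam2 :: "var \<Rightarrow> var \<Rightarrow> trm \<Rightarrow> trm" where
  "Lam2 v w t \<equiv> Lam v (Lam w t)"

abbreviation Lam3 :: "var \<Rightarrow> var \<Rightarrow> var \<Rightarrow> trm \<Rightarrow> trm" where
  "Lam3 u v w t \<equiv> Lam u (Lam v (Lam w t))"

definition predT :: trm where
  "predT = Lam (nv 0) (apps (CRec [TNat] 0) [Var (nv 0), CZero, Lam2 (nv 1) (nv 2) (Var (nv 2))])"

text \<open>\<open>ifzT \<cdot> n \<cdot> a \<cdot> b\<close> is \<open>a\<close> if \<open>n = 0\<close> and \<open>b\<close> otherwise.\<close>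

definition ifzT :: trm where
  "ifzT = Lam3 (nv 0) (nv 1) (nv 2)
     (apps (CRec [TNat] 0) [Var (nv 0), Var (nv 1), Lam2 (nv 3) (nv 4) (Var (nv 2))])"

text \<open>
  The inverses \<open>unpairT 0\<close> and \<open>unpairT 1\<close> of \<open>j\<close> are defined by simultaneous recursion: 0 is
  \<open>j 0 0\<close>, and if \<open>n = j a b\<close> then \<open>n + 1\<close> is \<open>j 0 (a + 1)\<close> if \<open>b = 0\<close> and \<open>j (a + 1) (b - 1)\<close>
  otherwise. The two step functions receive \<open>a\<close>, \<open>b\<close> and \<open>n\<close>.
\<close>

definition unpairT :: "nat \<Rightarrow> trm" where
  "unpairT i =
     (let a = Var (nv 1); b = Var (nv 2) in
      Lam (nv 0) (apps (CRec [TNat, TNat] i)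
        [Var (nv 0), CZero, CZero,
         Lam3 (nv 1) (nv 2) (nv 3) (ifzT \<cdot> b \<cdot> CZero \<cdot> (CSuc \<cdot> a)),
         Lam3 (nv 1) (nv 2) (nv 3) (ifzT \<cdot> b \<cdot> (CSuc \<cdot> a) \<cdot> (predT \<cdot> b))]))"

definition hdT :: trm where
  "hdT = Lam (nv 0) (unpairT 0 \<cdot> (predT \<cdot> Var (nv 0)))"

definition tlT :: trm where
  "tlT = Lam (nv 0) (unpairT 1 \<cdot> (predT \<cdot> Var (nv 0)))"

text \<open>\<open>dropT \<cdot> i \<cdot> c\<close> codes the sequence coded by \<open>c\<close> without its first \<open>i\<close> components.\<close>

definition dropT :: trm where
  "dropT = Lam2 (nv 0) (nv 1)
     (apps (CRec [TNat] 0) [Var (nv 0), Var (nv 1), Lam2 (nv 2) (nv 3) (tlT \<cdot> Var (nv 2))])"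

text \<open>
  The formula saying that \<open>s\<close> is a component of the sequence coded by \<open>c\<close>: for some \<open>i\<close> below
  the length of that sequence (i.e. with \<open>dropT \<cdot> i \<cdot> c\<close> nonempty), \<open>s\<close> is its \<open>i\<close>-th component.
\<close>

definition InSeq :: "trm \<Rightarrow> trm \<Rightarrow> fm" where
  "InSeq s c =
     (let i = fresh (fv_trm s \<union> fv_trm c) TNat in
      Exists i (Conj (Neg (Eq (dropT \<cdot> Var i \<cdot> c) CZero)) (Eq s (hdT \<cdot> (dropT \<cdot> Var i \<cdot> c)))))"

lemma closed_decoding_terms:
  "has_type hdT (TNat \<Rrightarrow> TNat)" "fv_trm hdT = {}"
  "has_type dropT (TNat \<Rrightarrow> TNat \<Rrightarrow> TNat)" "fv_trm dropT = {}"
  by (simp_all add: has_type_def hdT_def tlT_def dropT_def unpairT_def predT_def ifzT_def Let_def)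

end

theory Submission
  imports Defs "HOL-Library.Nat_Bijection"
begin

text \<open>
  Unprovability is shown by a model, the hereditarily effective operations: objects of each finite
  type are represented by numbers that are codes of programs, type 0 consists of all numbers, and
  a code represents an object of type $\rho \to \tau$ if its program converges on all codes of
  objects of type $\rho$ and takes codes of equal objects to codes of equal objects of type $\tau$.
  Equality at each type is thus a partial equivalence relation \<open>per\<close> on the numbers. This is a model
  of the theory (\<open>soundness\<close>): extensionality is built into the relation, induction is true since
  the numbers are standard, and the programming language has the combinators and the recursors.

  In this model every function \<open>f\<close> of type 1 is computed by a program whose code \<open>a\<close> is again a
  number and so can be an argument of \<open>f\<close>. Write $\{a\}(b)$ for the result of the program \<open>a\<close> on
  input \<open>b\<close>, and let $\varphi(x,y)$ say that \<open>y\<close> is not a component of the sequence coded by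
  $\{x\}(x)$ if the latter is defined. For each \<open>x\<close> there is such a \<open>y\<close>, as a finite sequence omits
  some number (\<open>finite_members\<close>). But no \<open>f\<close> lists candidates: if \<open>a\<close> is a code of \<open>f\<close>, then at
  \<open>x = a\<close> the components of $f(a) = \{a\}(a)$ are exactly the numbers that $\varphi(a,y)$ excludes.

  What remains is to express $\varphi$ in the language, without parameters. The programming language
  is a small partial combinatory algebra, given by an inductive definition with six rules. That
  $\{a\}(b) = c$ holds means that there is a finite derivation; since every finite table is an object
  of type 1, a derivation can be quantified over as three functions of type 1 (\<open>ap_iff_tables\<close>), and
  the rules themselves only involve pairs, which are decoded by the closed terms \<open>unpairT\<close>.
  The simultaneous recursors need not be rules: they are programmed with tuples from the single
  recursor (\<open>simrecT_denotes\<close>).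
\<close>

section \<open>A partial combinatory algebra on the natural numbers\<close>

abbreviation pr :: "nat \<Rightarrow> nat \<Rightarrow> nat" where
  "pr a b \<equiv> prod_encode (a, b)"

abbreviation lft :: "nat \<Rightarrow> nat" where
  "lft n \<equiv> fst (prod_decode n)"

abbreviation rgt :: "nat \<Rightarrow> nat" where
  "rgt n \<equiv> snd (prod_decode n)"

text \<open>
  \<open>ap a b c\<close> is the graph of application, $\{a\}(b) = c$. A program is a pair of a tag and data.
  Constants of several arguments collect them one at a time: tag 2 takes the first argument and
  tag 3 the second, each remembering the tag under which the computation is to go on. Tag 4 is
  the combinator $S$ applied to \<open>p\<close> and \<open>q\<close>, and tag 5 is the recursor applied to a number and an
  initial value, waiting for its step function. There is no rule for $K$, because recursion down
  to 0 returns the initial value and ignores the step function: $K$ is the recursor applied to 0.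

  The rules are few because a formula of the language has to describe them. In particular the
  recursor is the single one; the simultaneous recursors are programmed from it below.
\<close>

inductive ap :: "nat \<Rightarrow> nat \<Rightarrow> nat \<Rightarrow> bool" where
  ap_suc: "ap (pr 0 p) b (Suc b)"
| ap_curry: "ap (pr 2 t) b (pr 3 (pr t b))"
| ap_collect: "ap (pr 3 (pr t p)) b (pr t (pr p b))"
| ap_S: "ap p b u \<Longrightarrow> ap q b v \<Longrightarrow> ap u v c \<Longrightarrow> ap (pr 4 (pr p q)) b c"
| ap_rec_zero: "ap (pr 5 (pr 0 y)) b y"
| ap_rec_suc: "ap (pr 5 (pr m y)) b u \<Longrightarrow> ap b u v \<Longrightarrow> ap v m c \<Longrightarrow>
    ap (pr 5 (pr (Suc m) y)) b c"

lemma ap_deterministic: "ap a b c \<Longrightarrow> ap a b c' \<Longrightarrow> c' = c"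
proof (induction arbitrary: c' rule: ap.induct)
  case (ap_suc p b)
  then show ?case by (auto elim: ap.cases)
next
  case (ap_curry t b)
  then show ?case by (auto elim: ap.cases)
next
  case (ap_collect t p b)
  then show ?case by (auto elim: ap.cases)
next
  case (ap_S p b u q v c)
  from ap_S.prems obtain u' v' where "ap p b u'" "ap q b v'" "ap u' v' c'"
    by (cases rule: ap.cases) auto
  with ap_S.IH show ?case by blast
next
  case (ap_rec_zero y b)
  then show ?case by (auto elim: ap.cases)
next
  case (ap_rec_suc m y b u v c)
  from ap_rec_suc.prems obtain u' v' where "ap (pr 5 (pr m y)) b u'" "ap b u' v'" "ap v' m c'"
    by (cases rule: ap.cases) auto
  with ap_rec_suc.IH show ?case by blast
qed

definition papp :: "nat \<Rightarrow> nat \<Rightarrow> nat option" where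
  "papp a b = (if \<exists>c. ap a b c then Some (THE c. ap a b c) else None)"

lemma papp_eq_Some: "papp a b = Some c \<longleftrightarrow> ap a b c"
proof
  assume "ap a b c"
  moreover from this have "(THE c. ap a b c) = c"
    by (blast intro: the_equality ap_deterministic)
  ultimately show "papp a b = Some c"
    by (auto simp: papp_def)
next
  assume "papp a b = Some c"
  then obtain d where "ap a b d" "c = (THE c. ap a b c)"
    by (auto simp: papp_def split: if_splits)
  then show "ap a b c"
    by (metis ap_deterministic the_equality)
qed

primrec aps :: "nat \<Rightarrow> nat list \<Rightarrow> nat \<Rightarrow> bool" where
  "aps a [] c \<longleftrightarrow> a = c"
| "aps a (b # bs) c \<longleftrightarrow> (\<exists>d. ap a b d \<and> aps d bs c)"

lemma aps_deterministic: "aps a bs c \<Longrightarrow> aps a bs c' \<Longrightarrow> c' = c"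
  by (induction bs arbitrary: a) (auto dest: ap_deterministic)

lemma aps_append: "aps a (bs @ cs) c \<longleftrightarrow> (\<exists>d. aps a bs d \<and> aps d cs c)"
  by (induction bs arbitrary: a) auto

abbreviation K_code :: nat where "K_code \<equiv> pr 3 (pr 5 0)"
abbreviation S_code :: nat where "S_code \<equiv> pr 2 4"
abbreviation R_code :: nat where "R_code \<equiv> pr 2 5"

lemma ap_K: "ap K_code a (pr 5 (pr 0 a))"
  by (rule ap_collect)

lemma aps_S:
  "aps S_code [p, q] (pr 4 (pr p q))"
  by (auto intro!: exI ap_curry ap_collect)

section \<open>Denotations of terms\<close>

text \<open>
  The value of a term in an environment of codes, undefined if some application in it diverges.
  Type annotations are ignored, so that the same terms and the same \<open>Lam\<close> also serve to write
  untyped programs. The parameter \<open>rc\<close> gives the codes of the recursors: they are programs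
  that are themselves obtained as values of terms, with every recursor constant read as the single
  recursor.
\<close>

primrec den :: "(nat \<Rightarrow> nat \<Rightarrow> nat) \<Rightarrow> (var \<Rightarrow> nat) \<Rightarrow> trm \<Rightarrow> nat option" where
  "den rc e (Var v) = Some (e v)"
| "den rc e CZero = Some 0"
| "den rc e CSuc = Some (pr 0 0)"
| "den rc e (CPi \<rho> \<tau>) = Some K_code"
| "den rc e (CSigma \<delta> \<rho> \<tau>) = Some S_code"
| "den rc e (CRec \<rho>s i) = Some (rc (length \<rho>s) i)"
| "den rc e (s \<cdot> t) = Option.bind (den rc e s) (\<lambda>a. Option.bind (den rc e t) (papp a))"

lemma den_App_eq_Some:
  "den rc e (s \<cdot> t) = Some c \<longleftrightarrow> (\<exists>a b. den rc e s = Some a \<and> den rc e t = Some b \<and> ap a b c)"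
  by (auto simp: bind_eq_Some_conv papp_eq_Some)

lemma den_AppI: "den rc e s = Some a \<Longrightarrow> den rc e t = Some b \<Longrightarrow> ap a b c \<Longrightarrow>
    den rc e (s \<cdot> t) = Some c"
  by (subst den_App_eq_Some) blast

lemma den_cong: "(\<And>v. v \<in> fv_trm t \<Longrightarrow> e v = e' v) \<Longrightarrow> den rc e t = den rc e' t"
  by (induction t) auto

lemma den_upd_fresh: "v \<notin> fv_trm t \<Longrightarrow> den rc (e(v := a)) t = den rc e t"
  by (rule den_cong) auto

lemma den_appsI:
  "den rc e t = Some a \<Longrightarrow> list_all2 (\<lambda>s b. den rc e s = Some b) ts bs \<Longrightarrow> aps a bs c \<Longrightarrow>
   den rc e (apps t ts) = Some c"
proof (induction ts arbitrary: t a bs)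
  case Nil
  then show ?case by simp
next
  case (Cons s ts)
  then obtain b bs' d where bs: "bs = b # bs'" "den rc e s = Some b"
      "list_all2 (\<lambda>s b. den rc e s = Some b) ts bs'" "ap a b d" "aps d bs' c"
    by (auto simp: list_all2_Cons1)
  have "den rc e (t \<cdot> s) = Some d"
    using Cons.prems(1) bs by (blast intro: den_AppI)
  with Cons.IH bs show ?case by auto
qed

lemma den_Sigma:
  assumes "den rc e s = Some p" "den rc e t = Some q"
  shows "den rc e (CSigma \<delta> \<rho> \<tau> \<cdot> s \<cdot> t) = Some (pr 4 (pr p q))"
  by (rule den_AppI[OF den_AppI[OF _ assms(1) ap_curry] assms(2) ap_collect]) simp

lemma Lam_App_bound:
  assumes "v \<in> fv_trm (s \<cdot> t)" "den rc e (Lam v s) = Some p" "den rc e (Lam v t) = Some q"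
  shows "den rc e (Lam v (s \<cdot> t)) = Some (pr 4 (pr p q))"
  using assms by (auto simp del: den.simps(7) intro: den_Sigma)

lemma Lam_constant:
  assumes "den rc e t = Some c" shows "den rc e (CPi \<rho> \<tau> \<cdot> t) = Some (pr 5 (pr 0 c))"
  using assms by (auto simp del: den.simps(7) intro!: den_AppI[where a=K_code] ap_K)

text \<open>
  \<open>Lam\<close> does not suspend the subterms that do not contain the abstracted variable; they are
  evaluated as soon as the abstraction is. The abstraction therefore need not have a value when its
  body has none, and that the body has a value for one argument is what makes it denote. As
  \<open>den\<close> is a function, the code \<open>p\<close> obtained from different arguments \<open>b\<close> is the same.
\<close>

lemma Lam_beta:
  "den rc (e(v := b)) t = Some c \<Longrightarrow> \<exists>p. den rc e (Lam v t) = Some p \<and> ap p b c"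
proof (induction t arbitrary: c)
  case (App s t)
  show ?case
  proof (cases "v \<in> fv_trm (s \<cdot> t)")
    case True
    from App.prems obtain a1 a2 where
      "den rc (e(v := b)) s = Some a1" "den rc (e(v := b)) t = Some a2" "ap a1 a2 c"
      by (subst (asm) den_App_eq_Some) blast
    moreover from this obtain p q where
      "den rc e (Lam v s) = Some p" "ap p b a1" "den rc e (Lam v t) = Some q" "ap q b a2"
      using App.IH by blast
    ultimately show ?thesis
      using Lam_App_bound[OF True] by (blast intro: ap_S)
  next
    case False
    then have "den rc e (s \<cdot> t) = Some c"
      using App.prems den_upd_fresh by metis
    with False show ?thesis
      using Lam_constant ap_rec_zero by (auto simp del: den.simps(7))
  qed
next
  case (Var w)
  show ?case
  proof (cases "w = v")
    case True
    have "den rc e (Lam v (Var v)) = Some (pr 4 (pr K_code K_code))"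
      by (auto simp del: den.simps(7) intro: den_Sigma)
    moreover have "ap (pr 4 (pr K_code K_code)) b b"
      by (rule ap_S[OF ap_K ap_K ap_rec_zero])
    ultimately show ?thesis using True Var by auto
  next
    case False
    with Var show ?thesis
      using Lam_constant[of rc e "Var w"] ap_rec_zero by (auto simp del: den.simps(7))
  qed
qed (use Lam_constant ap_rec_zero in \<open>auto simp del: den.simps(7)\<close>)

abbreviation Lams :: "var list \<Rightarrow> trm \<Rightarrow> trm" where
  "Lams vs t \<equiv> foldr Lam vs t"

primrec upds :: "(var \<Rightarrow> nat) \<Rightarrow> var list \<Rightarrow> nat list \<Rightarrow> var \<Rightarrow> nat" where
  "upds e [] as = e"
| "upds e (v # vs) as = upds (e(v := hd as)) vs (tl as)"

lemma Lams_beta: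
  "length as = length vs \<Longrightarrow> den rc (upds e vs as) t = Some c \<Longrightarrow>
   \<exists>p. den rc e (Lams vs t) = Some p \<and> aps p as c"
proof (induction vs arbitrary: e as)
  case Nil
  then show ?case by simp
next
  case (Cons v vs)
  then obtain a as' where as: "as = a # as'" "length as' = length vs"
    by (metis length_Suc_conv)
  then obtain p where "den rc (e(v := a)) (Lams vs t) = Some p" "aps p as' c"
    using Cons.IH[of as' "e(v := a)"] Cons.prems by (auto simp del: fun_upd_apply)
  moreover from this obtain q where "den rc e (Lam v (Lams vs t)) = Some q" "ap q a p"
    using Lam_beta by blast
  ultimately show ?case using as by auto
qed

lemma upds_other: "w \<notin> set vs \<Longrightarrow> upds e vs as w = e w"
  by (induction vs arbitrary: e as) auto

lemma upds_nth:
  "distinct vs \<Longrightarrow> length as = length vs \<Longrightarrow> j < length vs \<Longrightarrow> upds e vs as (vs ! j) = as ! j"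
proof (induction vs arbitrary: e as j)
  case (Cons v vs)
  then show ?case
    by (cases as; cases j) (auto simp: upds_other)
qed simp

lemma upds_append:
  "length as = length vs \<Longrightarrow> upds e (vs @ ws) (as @ bs) = upds (upds e vs as) ws bs"
proof (induction vs arbitrary: e as)
  case (Cons v vs)
  then show ?case by (cases as) (auto simp del: fun_upd_apply)
qed simp

section \<open>Simultaneous recursion by tuples\<close>

text \<open>
  Church's tuples: the tuple of \<open>rs\<close> applies its argument to all components in turn. Being untyped,
  one such code can be projected to components of different types, which lets a single recursion
  compute all values of a simultaneous recursion at once.
\<close>

definition tupled :: "nat \<Rightarrow> nat list \<Rightarrow> bool" where
  "tupled g rs \<longleftrightarrow> (\<forall>q c. aps q rs c \<longrightarrow> ap g q c)"

text \<open>
  The names 0 to 3 are kept for the recursion argument, the argument of a tuple, and the two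
  arguments of the step function.
\<close>

definition yvars :: "nat \<Rightarrow> var list" where
  "yvars k = map (\<lambda>j. nv (4 + j)) [0..<k]"

definition zvars :: "nat \<Rightarrow> var list" where
  "zvars k = map (\<lambda>j. nv (4 + k + j)) [0..<k]"

definition rvars :: "nat \<Rightarrow> var list" where
  "rvars k = map (\<lambda>j. nv (4 + 2 * k + j)) [0..<k]"

definition tupleT :: "trm list \<Rightarrow> trm" where
  "tupleT ts = Lam (nv 1) (apps (Var (nv 1)) ts)"

definition stepT :: "nat \<Rightarrow> trm" where
  "stepT k = Lams [nv 2, nv 3] (Var (nv 2) \<cdot> Lams (rvars k)
     (tupleT (map (\<lambda>z. apps (Var z) (map Var (rvars k) @ [Var (nv 3)])) (zvars k))))"

text \<open>
  The step function passes to the tuple of the values at \<open>m\<close> a function that builds from them the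
  tuple of the values at \<open>m + 1\<close>; at the end the \<open>i\<close>-th component is projected out.
\<close>

definition simrecT :: "nat \<Rightarrow> nat \<Rightarrow> trm" where
  "simrecT k i = Lams (nv 0 # yvars k @ zvars k)
     (CRec [TNat] 0 \<cdot> Var (nv 0) \<cdot> tupleT (map Var (yvars k)) \<cdot> stepT k
        \<cdot> Lams (rvars k) (Var (rvars k ! i)))"

abbreviation den0 :: "(var \<Rightarrow> nat) \<Rightarrow> trm \<Rightarrow> nat option" where
  "den0 \<equiv> den (\<lambda>_ _. R_code)"

lemma distinct_vars:
  "distinct (yvars k)" "distinct (zvars k)" "distinct (rvars k)"
  by (auto simp: yvars_def zvars_def rvars_def distinct_map inj_on_def)

lemma length_vars [simp]:
  "length (yvars k) = k" "length (zvars k) = k" "length (rvars k) = k"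
  by (auto simp: yvars_def zvars_def rvars_def)

lemma projection_denotes:
  assumes "i < k" "length rs = k"
  shows "\<exists>p. den rc e (Lams (rvars k) (Var (rvars k ! i))) = Some p \<and> aps p rs (rs ! i)"
  using assms by (intro Lams_beta) (simp_all add: upds_nth distinct_vars)

lemma tupleT_denotes:
  assumes den: "list_all2 (\<lambda>t a. den rc e t = Some a) ts as"
    and fresh: "\<And>t. t \<in> set ts \<Longrightarrow> nv 1 \<notin> fv_trm t"
    and q: "aps q as c"
  shows "\<exists>g. den rc e (tupleT ts) = Some g \<and> tupled g as"
proof -
  have "den rc (e(nv 1 := q')) (apps (Var (nv 1)) ts) = Some c'" if "aps q' as c'" for q' c'
  proof (rule den_appsI[where bs = as and a = q'])
    show "list_all2 (\<lambda>t a. den rc (e(nv 1 := q')) t = Some a) ts as"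
      using den fresh by (auto simp: list_all2_conv_all_nth den_upd_fresh)
  qed (use that in auto)
  then show ?thesis
    using q Lam_beta[of rc e "nv 1" _ "apps (Var (nv 1)) ts"]
    unfolding tupleT_def tupled_def by (metis option.inject)
qed

text \<open>
  Some selector on which the tuple converges is what \<open>tupleT_denotes\<close> needs in order to know that
  the tuple itself denotes; this is where tuples have to be nonempty.
\<close>

lemma projection_exists:
  assumes "i < length rs" shows "\<exists>q. aps q rs (rs ! i)"
  using projection_denotes[OF assms refl] by blast

lemma list_all2_Var_upds:
  "distinct vs \<Longrightarrow> length as = length vs \<Longrightarrow>
   list_all2 (\<lambda>t a. den rc (upds e vs as) t = Some a) (map Var vs) as"
  by (simp add: list_all2_conv_all_nth upds_nth)

lemma stepT_denotes:
  assumes zs: "\<And>j. j < k \<Longrightarrow> e (zvars k ! j) = zs ! j"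
    and k: "0 < k" "length rs = k" "length rs' = k"
    and step: "\<And>j. j < k \<Longrightarrow> aps (zs ! j) (rs @ [n]) (rs' ! j)"
    and g: "tupled g rs"
  shows "\<exists>s g'. den rc e (stepT k) = Some s \<and> aps s [g, n] g' \<and> tupled g' rs'"
proof -
  let ?e = "e(nv 2 := g, nv 3 := n)"
  let ?e' = "upds ?e (rvars k) rs"
  let ?ts = "map (\<lambda>z. apps (Var z) (map Var (rvars k) @ [Var (nv 3)])) (zvars k)"
  have e'n: "?e' (nv 3) = n"
    by (subst upds_other) (auto simp: rvars_def)
  have e'z: "?e' (zvars k ! j) = zs ! j" if "j < k" for j
    using that zs by (subst upds_other) (auto simp: rvars_def zvars_def)
  have "den rc ?e' (apps (Var (zvars k ! j)) (map Var (rvars k) @ [Var (nv 3)])) = Some (rs' ! j)"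
    if "j < k" for j
  proof (rule den_appsI[where a = "zs ! j" and bs = "rs @ [n]"])
    show "list_all2 (\<lambda>s b. den rc ?e' s = Some b) (map Var (rvars k) @ [Var (nv 3)]) (rs @ [n])"
      using list_all2_Var_upds[of "rvars k" rs rc ?e] k(2)
      by (intro list_all2_appendI) (simp_all add: e'n distinct_vars)
  qed (use that e'z step in auto)
  then have "list_all2 (\<lambda>t a. den rc ?e' t = Some a) ?ts rs'"
    using k by (auto simp: list_all2_conv_all_nth)
  moreover have "nv 1 \<notin> fv_trm t" if "t \<in> set ?ts" for t
  proof -
    have *: "fv_trm (apps s us) = fv_trm s \<union> \<Union> (fv_trm ` set us)" for s us
      by (induction us arbitrary: s) auto
    show ?thesis using that by (auto simp: * rvars_def zvars_def)
  qed
  moreover obtain q where "aps q rs' (rs' ! 0)"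
    using projection_exists k by metis
  ultimately obtain g' where g': "den rc ?e' (tupleT ?ts) = Some g'" "tupled g' rs'"
    using tupleT_denotes by blast
  then obtain h where h: "den rc ?e (Lams (rvars k) (tupleT ?ts)) = Some h" "aps h rs g'"
    using Lams_beta k(2) by (metis length_vars(3))
  then have "ap g h g'" using g by (auto simp: tupled_def)
  with h have "den rc ?e (Var (nv 2) \<cdot> Lams (rvars k) (tupleT ?ts)) = Some g'"
    by (intro den_AppI) auto
  then have "den rc (upds e [nv 2, nv 3] [g, n]) (Var (nv 2) \<cdot> Lams (rvars k) (tupleT ?ts)) = Some g'"
    by simp
  from Lams_beta[OF _ this] g'(2) show ?thesis
    unfolding stepT_def by (simp only: list.size) blast
qed

text \<open>
  The assumptions present a simultaneous recursion through the sequence \<open>rs\<close> of its values, so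
  that no typing is involved. Totality of that sequence is needed even at \<open>n = 0\<close>, since the
  step function is evaluated before the recursion starts.
\<close>

lemma simrecT_denotes:
  assumes k: "i < k" "length ys = k" "length zs = k"
    and rs: "\<And>n. length (rs n) = k" "rs 0 = ys"
      "\<And>n j. j < k \<Longrightarrow> aps (zs ! j) (rs n @ [n]) (rs (Suc n) ! j)"
  shows "\<exists>p. den0 e (simrecT k i) = Some p \<and> aps p (n # ys @ zs) (rs n ! i)"
proof -
  let ?e = "upds e (nv 0 # yvars k @ zvars k) (n # ys @ zs)"
  have upd: "?e = upds (upds (e(nv 0 := n)) (yvars k) ys) (zvars k) zs"
    by (simp add: upds_append k)
  have fresh: "nv 0 \<notin> set (yvars k)" "nv 0 \<notin> set (zvars k)" "yvars k ! j \<notin> set (zvars k)" if "j < k" for j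
    using that by (auto simp: yvars_def zvars_def)
  have n: "?e (nv 0) = n"
    unfolding upd using fresh k by (simp add: upds_other)
  have z: "?e (zvars k ! j) = zs ! j" if "j < k" for j
    unfolding upd using that k by (simp add: upds_nth distinct_vars)
  have y: "?e (yvars k ! j) = ys ! j" if "j < k" for j
    unfolding upd using that k fresh by (simp add: upds_other upds_nth distinct_vars)
  have "list_all2 (\<lambda>t a. den0 ?e t = Some a) (map Var (yvars k)) ys"
    using k y by (simp add: list_all2_conv_all_nth)
  moreover have "nv 1 \<notin> fv_trm t" if "t \<in> set (map Var (yvars k))" for t
    using that by (auto simp: yvars_def)
  moreover obtain q where "aps q ys (ys ! i)"
    using projection_exists k by metis
  ultimately obtain b where b: "den0 ?e (tupleT (map Var (yvars k))) = Some b" "tupled b ys"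
    using tupleT_denotes by blast
  have step: "\<exists>s g'. den0 ?e (stepT k) = Some s \<and> aps s [g, m] g' \<and> tupled g' (rs (Suc m))"
    if "tupled g (rs m)" for g m
    using stepT_denotes[of k ?e zs "rs m" "rs (Suc m)" m g] z k rs that by auto
  \<comment> \<open>The tuple of initial values witnesses that the step function denotes.\<close>
  then obtain s where s: "den0 ?e (stepT k) = Some s"
    using b rs(2) by metis
  have "\<exists>g. ap (pr 5 (pr m b)) s g \<and> tupled g (rs m)" for m
  proof (induction m)
    case 0
    then show ?case using b rs(2) ap_rec_zero by auto
  next
    case (Suc m)
    then obtain g where g: "ap (pr 5 (pr m b)) s g" "tupled g (rs m)" by blast
    with step s obtain g' where "aps s [g, m] g'" "tupled g' (rs (Suc m))"
      by fastforce
    then show ?case using g(1) by (auto intro: ap_rec_suc)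
  qed
  then obtain g where g: "ap (pr 5 (pr n b)) s g" "tupled g (rs n)" by blast
  obtain p where p: "den0 ?e (Lams (rvars k) (Var (rvars k ! i))) = Some p" "aps p (rs n) (rs n ! i)"
    using projection_denotes k rs(1) by metis
  have "ap R_code n (pr 3 (pr 5 n))" "ap (pr 3 (pr 5 n)) b (pr 5 (pr n b))"
    by (rule ap_curry, rule ap_collect)
  moreover have "den0 ?e (CRec [TNat] 0) = Some R_code" "den0 ?e (Var (nv 0)) = Some n"
    using n by simp_all
  moreover have "ap g p (rs n ! i)" using g p by (simp add: tupled_def)
  ultimately have "den0 ?e (CRec [TNat] 0 \<cdot> Var (nv 0) \<cdot> tupleT (map Var (yvars k)) \<cdot> stepT k
        \<cdot> Lams (rvars k) (Var (rvars k ! i))) = Some (rs n ! i)"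
    using b(1) s g(1) p(1) by (blast intro: den_AppI)
  then show ?thesis
    unfolding simrecT_def by (intro Lams_beta) (auto simp: k)
qed

text \<open>
  The programs are closed, so the environment is arbitrary.
\<close>

definition rec_code :: "nat \<Rightarrow> nat \<Rightarrow> nat" where
  "rec_code k i = the (den0 (\<lambda>_. 0) (simrecT k i))"

abbreviation dn :: "(var \<Rightarrow> nat) \<Rightarrow> trm \<Rightarrow> nat option" where
  "dn \<equiv> den rec_code"

lemma aps_rec_code:
  assumes "i < k" "length ys = k" "length zs = k"
    and "\<And>n. length (rs n) = k" "rs 0 = ys"
      "\<And>n j. j < k \<Longrightarrow> aps (zs ! j) (rs n @ [n]) (rs (Suc n) ! j)"
  shows "aps (rec_code k i) (n # ys @ zs) (rs n ! i)"
  using simrecT_denotes[OF assms, of "\<lambda>_. 0" n] by (auto simp: rec_code_def)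

section \<open>The hereditarily effective operations\<close>

text \<open>
  Two codes represent the same object of type \<open>\<sigma>\<close> if they are \<open>per \<sigma>\<close>-related, and \<open>a\<close> represents
  an object of this type at all if \<open>per \<sigma> a a\<close>. At type 0 every number represents itself.
\<close>

primrec per :: "ty \<Rightarrow> nat \<Rightarrow> nat \<Rightarrow> bool" where
  "per TNat a b \<longleftrightarrow> a = b"
| "per (\<rho> \<Rrightarrow> \<tau>) a b \<longleftrightarrow> (\<forall>c d. per \<rho> c d \<longrightarrow> (\<exists>u v. ap a c u \<and> ap b d v \<and> per \<tau> u v))"

lemma per_appE:
  assumes "per (\<rho> \<Rrightarrow> \<tau>) a b" "per \<rho> c d"
  obtains u v where "ap a c u" "ap b d v" "per \<tau> u v"
  using assms unfolding per.simps by blast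

lemma per_sym_trans:
  "(\<forall>a b. per \<sigma> a b \<longrightarrow> per \<sigma> b a) \<and> (\<forall>a b c. per \<sigma> a b \<longrightarrow> per \<sigma> b c \<longrightarrow> per \<sigma> a c)"
proof (induction \<sigma>)
  case TNat
  then show ?case by simp
next
  case (TFun \<rho> \<tau>)
  then have \<rho>: "per \<rho> a b \<Longrightarrow> per \<rho> b a" "per \<rho> a b \<Longrightarrow> per \<rho> b c \<Longrightarrow> per \<rho> a c"
    and \<tau>: "per \<tau> a b \<Longrightarrow> per \<tau> b a" "per \<tau> a b \<Longrightarrow> per \<tau> b c \<Longrightarrow> per \<tau> a c" for a b c
    by blast+
  have "per (\<rho> \<Rrightarrow> \<tau>) b a" if "per (\<rho> \<Rrightarrow> \<tau>) a b" for a b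
    using that \<rho>(1) \<tau>(1) unfolding per.simps by blast
  moreover have "per (\<rho> \<Rrightarrow> \<tau>) a c" if ab: "per (\<rho> \<Rrightarrow> \<tau>) a b" and bc: "per (\<rho> \<Rrightarrow> \<tau>) b c" for a b c
    unfolding per.simps
  proof (intro allI impI)
    fix x y assume "per \<rho> x y"
    then have "per \<rho> x x" using \<rho> by blast
    from ab this obtain u v where "ap a x u" "ap b x v" "per \<tau> u v" by (rule per_appE)
    moreover obtain v' w where "ap b x v'" "ap c y w" "per \<tau> v' w"
      using bc \<open>per \<rho> x y\<close> by (rule per_appE)
    ultimately show "\<exists>u w. ap a x u \<and> ap c y w \<and> per \<tau> u w"
      using \<tau>(2) ap_deterministic by blast
  qed
  ultimately show ?case by blast
qed

lemma per_sym: "per \<sigma> a b \<Longrightarrow> per \<sigma> b a"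
  and per_trans: "per \<sigma> a b \<Longrightarrow> per \<sigma> b c \<Longrightarrow> per \<sigma> a c"
  using per_sym_trans by blast+

text \<open>
  Constant functions, given by $K$, inhabit all function types.
\<close>

lemma per_inhabited: "\<exists>a. per \<sigma> a a"
proof (induction \<sigma>)
  case (TFun \<rho> \<tau>)
  then obtain a where "per \<tau> a a" by blast
  then have "per (\<rho> \<Rrightarrow> \<tau>) (pr 5 (pr 0 a)) (pr 5 (pr 0 a))"
    by (auto intro: ap_rec_zero)
  then show ?case by blast
qed simp

text \<open>
  Pairs of argument lists are compared along \<open>zip\<close> here, which is the form that induction on
  the list of types can take apart.
\<close>

lemma per_arrowsD:
  "per (arrows \<rho>s \<tau>) a b \<Longrightarrow> list_all2 (\<lambda>\<rho> (c, d). per \<rho> c d) \<rho>s (zip cs ds) \<Longrightarrow> length cs = length ds \<Longrightarrow>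
   \<exists>u v. aps a cs u \<and> aps b ds v \<and> per \<tau> u v"
proof (induction \<rho>s arbitrary: a b cs ds)
  case Nil
  then show ?case by auto
next
  case (Cons \<rho> \<rho>s)
  then obtain c cs' d ds' where *: "cs = c # cs'" "ds = d # ds'"
    by (cases cs; cases ds) auto
  have "per (\<rho> \<Rrightarrow> arrows \<rho>s \<tau>) a b" "per \<rho> c d"
    using Cons.prems * by simp_all
  then obtain u v where "ap a c u" "ap b d v" "per (arrows \<rho>s \<tau>) u v"
    by (rule per_appE)
  then show ?case
    using Cons.IH[of u v cs' ds'] Cons.prems * by auto
qed

lemma arrows_inhabited: "\<exists>cs. list_all2 (\<lambda>\<rho> (c, d). per \<rho> c d) \<rho>s (zip cs cs) \<and> length cs = length \<rho>s"
proof (induction \<rho>s)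
  case (Cons \<rho> \<rho>s)
  then obtain cs c where "list_all2 (\<lambda>\<rho> (c, d). per \<rho> c d) \<rho>s (zip cs cs)" "length cs = length \<rho>s" "per \<rho> c c"
    using per_inhabited by blast
  then show ?case by (intro exI[of _ "c # cs"]) auto
qed simp

text \<open>
  It suffices to look at complete lists of arguments: a partial application converges because it
  can be completed, all types being inhabited.
\<close>

lemma per_arrowsI:
  assumes "\<And>cs ds. list_all2 (\<lambda>\<rho> (c, d). per \<rho> c d) \<rho>s (zip cs ds) \<Longrightarrow> length cs = length \<rho>s \<Longrightarrow> length ds = length \<rho>s \<Longrightarrow>
    \<exists>u v. aps a cs u \<and> aps b ds v \<and> per \<tau> u v"
  shows "per (arrows \<rho>s \<tau>) a b"
  using assms
proof (induction \<rho>s arbitrary: a b)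
  case Nil
  from Nil[of "[]" "[]"] show ?case by simp
next
  case (Cons \<rho> \<rho>s)
  show ?case
    unfolding foldr.simps comp_apply per.simps
  proof (intro allI impI)
    fix c d assume cd: "per \<rho> c d"
    obtain es where es: "list_all2 (\<lambda>\<rho> (c, d). per \<rho> c d) \<rho>s (zip es es)" "length es = length \<rho>s"
      using arrows_inhabited by blast
    obtain u v where uv: "ap a c u" "ap b d v"
      using Cons.prems[of "c # es" "d # es"] cd es by auto
    have "per (arrows \<rho>s \<tau>) u v"
    proof (rule Cons.IH)
      fix cs ds
      assume "list_all2 (\<lambda>\<rho> (c, d). per \<rho> c d) \<rho>s (zip cs ds)" "length cs = length \<rho>s" "length ds = length \<rho>s"
      then show "\<exists>u' v'. aps u cs u' \<and> aps v ds v' \<and> per \<tau> u' v'"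
        using Cons.prems[of "c # cs" "d # ds"] cd uv by (auto dest: ap_deterministic)
    qed
    with uv show "\<exists>u v. ap a c u \<and> ap b d v \<and> per (arrows \<rho>s \<tau>) u v" by blast
  qed
qed

text \<open>
  The values of the simultaneous recursion with initial values \<open>ys\<close> and step functions \<open>zs\<close>;
  meaningful only if the step functions converge, as well-typed ones do.
\<close>

primrec recseq :: "nat list \<Rightarrow> nat list \<Rightarrow> nat \<Rightarrow> nat list" where
  "recseq ys zs 0 = ys"
| "recseq ys zs (Suc n) = map (\<lambda>z. THE c. aps z (recseq ys zs n @ [n]) c) zs"

abbreviation pers :: "ty list \<Rightarrow> nat list \<Rightarrow> nat list \<Rightarrow> bool" where
  "pers \<rho>s cs ds \<equiv> length cs = length \<rho>s \<and> length ds = length \<rho>s \<and> (\<forall>j<length \<rho>s. per (\<rho>s ! j) (cs ! j) (ds ! j))"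

lemma pers_iff: "pers \<rho>s cs ds \<longleftrightarrow>
  list_all2 (\<lambda>\<rho> (c, d). per \<rho> c d) \<rho>s (zip cs ds) \<and> length cs = length \<rho>s \<and> length ds = length \<rho>s"
  by (auto simp: list_all2_conv_all_nth)

abbreviation step_types :: "ty list \<Rightarrow> ty list" where
  "step_types \<rho>s \<equiv> map (\<lambda>\<rho>. arrows \<rho>s (TNat \<Rrightarrow> \<rho>)) \<rho>s"

lemma the_aps: "aps z cs u \<Longrightarrow> (THE c. aps z cs c) = u"
  by (blast intro: the_equality aps_deterministic)

lemma recseq_step:
  assumes zs: "pers (step_types \<rho>s) zs zs'" and r: "pers \<rho>s (recseq ys zs n) (recseq ys' zs' n)" and j: "j < length \<rho>s"
  shows "aps (zs ! j) (recseq ys zs n @ [n]) (recseq ys zs (Suc n) ! j)"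
    and "aps (zs' ! j) (recseq ys' zs' n @ [n]) (recseq ys' zs' (Suc n) ! j)"
    and "per (\<rho>s ! j) (recseq ys zs (Suc n) ! j) (recseq ys' zs' (Suc n) ! j)"
proof -
  have "per (arrows (\<rho>s @ [TNat]) (\<rho>s ! j)) (zs ! j) (zs' ! j)"
    using zs j by auto
  moreover have "pers (\<rho>s @ [TNat]) (recseq ys zs n @ [n]) (recseq ys' zs' n @ [n])"
    using r by (auto simp: nth_append less_Suc_eq)
  ultimately have "\<exists>u v. aps (zs ! j) (recseq ys zs n @ [n]) u \<and>
    aps (zs' ! j) (recseq ys' zs' n @ [n]) v \<and> per (\<rho>s ! j) u v"
    using per_arrowsD[of "\<rho>s @ [TNat]" "\<rho>s ! j" "zs ! j" "zs' ! j" "recseq ys zs n @ [n]" "recseq ys' zs' n @ [n]"]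
    unfolding pers_iff by presburger
  then obtain u v where "aps (zs ! j) (recseq ys zs n @ [n]) u"
    "aps (zs' ! j) (recseq ys' zs' n @ [n]) v" "per (\<rho>s ! j) u v"
    by blast
  then show "aps (zs ! j) (recseq ys zs n @ [n]) (recseq ys zs (Suc n) ! j)"
    "aps (zs' ! j) (recseq ys' zs' n @ [n]) (recseq ys' zs' (Suc n) ! j)"
    "per (\<rho>s ! j) (recseq ys zs (Suc n) ! j) (recseq ys' zs' (Suc n) ! j)"
    using zs j by (auto simp: the_aps)
qed

lemma per_recseq:
  assumes "pers \<rho>s ys ys'" "pers (step_types \<rho>s) zs zs'"
  shows "pers \<rho>s (recseq ys zs n) (recseq ys' zs' n)"
proof (induction n)
  case (Suc n)
  then show ?case using assms(2) recseq_step(3)[OF assms(2) Suc] by simp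
qed (use assms in simp)

lemma aps_recseq:
  assumes "pers \<rho>s ys ys'" "pers (step_types \<rho>s) zs zs'" "i < length \<rho>s"
  shows "aps (rec_code (length \<rho>s) i) (n # ys @ zs) (recseq ys zs n ! i)"
    "aps (rec_code (length \<rho>s) i) (n # ys' @ zs') (recseq ys' zs' n ! i)"
proof -
  note rec = per_recseq[OF assms(1,2)]
  note step = recseq_step[OF assms(2) rec]
  show "aps (rec_code (length \<rho>s) i) (n # ys @ zs) (recseq ys zs n ! i)"
    by (rule aps_rec_code[OF assms(3)]) (use assms rec step(1) in \<open>simp_all del: recseq.simps(2)\<close>)
  show "aps (rec_code (length \<rho>s) i) (n # ys' @ zs') (recseq ys' zs' n ! i)"
    by (rule aps_rec_code[OF assms(3)]) (use assms rec step(2) in \<open>simp_all del: recseq.simps(2)\<close>)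
qed

text \<open>
  Related initial values and step functions have related recursion sequences, by induction on the
  recursion argument.
\<close>

lemma per_rec_code:
  assumes i: "i < length \<rho>s"
  shows "per (TNat \<Rrightarrow> arrows \<rho>s (arrows (step_types \<rho>s) (\<rho>s ! i)))
    (rec_code (length \<rho>s) i) (rec_code (length \<rho>s) i)"
proof -
  have "per (arrows (TNat # \<rho>s @ step_types \<rho>s) (\<rho>s ! i)) (rec_code (length \<rho>s) i) (rec_code (length \<rho>s) i)"
  proof (rule per_arrowsI)
    let ?k = "length \<rho>s"
    fix cs ds
    assume "list_all2 (\<lambda>\<rho> (c, d). per \<rho> c d) (TNat # \<rho>s @ step_types \<rho>s) (zip cs ds)"
      "length cs = length (TNat # \<rho>s @ step_types \<rho>s)" "length ds = length (TNat # \<rho>s @ step_types \<rho>s)"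
    then have *: "pers (TNat # \<rho>s @ step_types \<rho>s) cs ds"
      unfolding pers_iff by blast
    then obtain n cs' n' ds' where cs: "cs = n # cs'" "ds = n' # ds'"
      by (cases cs; cases ds) auto
    have "per ((TNat # \<rho>s @ step_types \<rho>s) ! 0) (cs ! 0) (ds ! 0)"
      using * by blast
    then have n: "n' = n" using cs by simp
    have cs': "per ((\<rho>s @ step_types \<rho>s) ! j) (cs' ! j) (ds' ! j)" if "j < 2 * ?k" for j
    proof -
      have "per ((TNat # \<rho>s @ step_types \<rho>s) ! Suc j) (cs ! Suc j) (ds ! Suc j)"
        using * that by (intro conjunct2[OF conjunct2[OF *], rule_format]) simp
      then show ?thesis using cs by simp
    qed
    have len: "length cs' = 2 * ?k" "length ds' = 2 * ?k" using * cs by auto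
    have ys: "pers \<rho>s (take ?k cs') (take ?k ds')"
    proof (intro HOL.conjI allI impI)
      fix j assume "j < ?k"
      then show "per (\<rho>s ! j) (take ?k cs' ! j) (take ?k ds' ! j)"
        using cs'[of j] len by (simp add: nth_append)
    qed (use len in auto)
    have zs: "pers (step_types \<rho>s) (drop ?k cs') (drop ?k ds')"
    proof (intro HOL.conjI allI impI)
      fix j assume "j < length (step_types \<rho>s)"
      then show "per (step_types \<rho>s ! j) (drop ?k cs' ! j) (drop ?k ds' ! j)"
        using cs'[of "?k + j"] len by (simp add: nth_append)
    qed (use len in auto)
    show "\<exists>u v. aps (rec_code ?k i) cs u \<and> aps (rec_code ?k i) ds v \<and> per (\<rho>s ! i) u v"
      using aps_recseq[OF ys zs i, of n] per_recseq[OF ys zs, of n] i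
      unfolding cs n append_take_drop_id by blast
  qed
  then show ?thesis by simp
qed

text \<open>
  Quantifiers will range over codes rather than over classes of related codes, and environments
  need no more than that each value represents an object of the type of its variable.
\<close>

definition adequate :: "(var \<Rightarrow> nat) \<Rightarrow> bool" where
  "adequate e \<longleftrightarrow> (\<forall>v. per (snd v) (e v) (e v))"

lemma adequate_upd: "adequate e \<Longrightarrow> per (snd v) a a \<Longrightarrow> adequate (e(v := a))"
  by (auto simp: adequate_def)

lemma adequate_exists: "\<exists>e. adequate e"
proof -
  obtain f where "per \<sigma> (f \<sigma>) (f \<sigma>)" for \<sigma>
    using per_inhabited by metis
  then have "adequate (\<lambda>v. f (snd v))" by (simp add: adequate_def)
  then show ?thesis by blast
qed

lemma per_K: "per (\<rho> \<Rrightarrow> \<tau> \<Rrightarrow> \<rho>) K_code K_code"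
  unfolding per.simps using ap_K ap_rec_zero by blast

lemma per_S: "per ((\<delta> \<Rrightarrow> \<rho> \<Rrightarrow> \<tau>) \<Rrightarrow> (\<delta> \<Rrightarrow> \<rho>) \<Rrightarrow> \<delta> \<Rrightarrow> \<tau>) S_code S_code"
proof -
  have "per (arrows [\<delta> \<Rrightarrow> \<rho> \<Rrightarrow> \<tau>, \<delta> \<Rrightarrow> \<rho>, \<delta>] \<tau>) S_code S_code"
  proof (rule per_arrowsI)
    fix cs ds
    assume *: "list_all2 (\<lambda>\<rho> (c, d). per \<rho> c d) [\<delta> \<Rrightarrow> \<rho> \<Rrightarrow> \<tau>, \<delta> \<Rrightarrow> \<rho>, \<delta>] (zip cs ds)"
      "length cs = length [\<delta> \<Rrightarrow> \<rho> \<Rrightarrow> \<tau>, \<delta> \<Rrightarrow> \<rho>, \<delta>]" "length ds = length [\<delta> \<Rrightarrow> \<rho> \<Rrightarrow> \<tau>, \<delta> \<Rrightarrow> \<rho>, \<delta>]"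
    obtain p q c where cs: "cs = [p, q, c]"
      using *(2) by (auto simp: length_Suc_conv)
    obtain p' q' c' where ds: "ds = [p', q', c']"
      using *(3) by (auto simp: length_Suc_conv)
    have p: "per (\<delta> \<Rrightarrow> \<rho> \<Rrightarrow> \<tau>) p p'" and q: "per (\<delta> \<Rrightarrow> \<rho>) q q'" and c: "per \<delta> c c'"
      using *(1) cs ds by simp_all
    from p c obtain u u' where u: "ap p c u" "ap p' c' u'" "per (\<rho> \<Rrightarrow> \<tau>) u u'" by (rule per_appE)
    from q c obtain v v' where v: "ap q c v" "ap q' c' v'" "per \<rho> v v'" by (rule per_appE)
    from u(3) v(3) obtain w w' where "ap u v w" "ap u' v' w'" "per \<tau> w w'" by (rule per_appE)
    with u v have "ap (pr 4 (pr p q)) c w" "ap (pr 4 (pr p' q')) c' w'" by (auto intro: ap_S)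
    moreover have "aps S_code [p, q] (pr 4 (pr p q))" "aps S_code [p', q'] (pr 4 (pr p' q'))"
      by (rule aps_S)+
    ultimately have "aps S_code ([p, q] @ [c]) w" "aps S_code ([p', q'] @ [c']) w'"
      unfolding aps_append by auto
    with \<open>per \<tau> w w'\<close> show "\<exists>u v. aps S_code cs u \<and> aps S_code ds v \<and> per \<tau> u v"
      unfolding cs ds by auto
  qed
  then show ?thesis by simp
qed

lemma has_type_App:
  "has_type (s \<cdot> t) \<tau> \<longleftrightarrow> (\<exists>\<rho>. has_type s (\<rho> \<Rrightarrow> \<tau>) \<and> has_type t \<rho>)"
  by (auto simp: has_type_def split: option.splits ty.splits if_splits)

lemma den_typed:
  "has_type t \<sigma> \<Longrightarrow> adequate e \<Longrightarrow> \<exists>a. dn e t = Some a \<and> per \<sigma> a a"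
proof (induction t arbitrary: \<sigma>)
  case (App s t)
  from App.prems(1) obtain \<rho> where "has_type s (\<rho> \<Rrightarrow> \<sigma>)" "has_type t \<rho>"
    unfolding has_type_App by blast
  then obtain a b where *: "dn e s = Some a" "per (\<rho> \<Rrightarrow> \<sigma>) a a" "dn e t = Some b" "per \<rho> b b"
    using App by blast
  from *(2,4) obtain c c' where c: "ap a b c" "ap a b c'" "per \<sigma> c c'"
    by (rule per_appE)
  then have "per \<sigma> c c" using ap_deterministic by blast
  with c show ?case using den_AppI[OF *(1,3)] by blast
next
  case (CRec \<rho>s i)
  then show ?case
    using per_rec_code[of i \<rho>s] by (auto simp: has_type_def split: if_splits)
next
  case (CPi \<rho> \<tau>)
  then show ?case using per_K by (auto simp: has_type_def simp del: per.simps)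
next
  case (CSigma \<delta> \<rho> \<tau>)
  then show ?case using per_S by (auto simp: has_type_def simp del: per.simps)
qed (auto simp: has_type_def adequate_def intro: ap_suc)


section \<open>Truth in the model\<close>

text \<open>
  Well-formed equations have terms of type 0 on both sides, whose codes are equal just when they
  represent the same number.
\<close>

primrec sat :: "(var \<Rightarrow> nat) \<Rightarrow> fm \<Rightarrow> bool" where
  "sat e (Eq s t) \<longleftrightarrow> dn e s = dn e t"
| "sat e Falsum \<longleftrightarrow> False"
| "sat e (Conj A B) \<longleftrightarrow> sat e A \<and> sat e B"
| "sat e (Disj A B) \<longleftrightarrow> sat e A \<or> sat e B"
| "sat e (Imp A B) \<longleftrightarrow> (sat e A \<longrightarrow> sat e B)"
| "sat e (Forall v A) \<longleftrightarrow> (\<forall>a. per (snd v) a a \<longrightarrow> sat (e(v := a)) A)"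
| "sat e (Exists v A) \<longleftrightarrow> (\<exists>a. per (snd v) a a \<and> sat (e(v := a)) A)"

lemma sat_cong: "(\<And>v. v \<in> fv_fm A \<Longrightarrow> e v = e' v) \<Longrightarrow> sat e A = sat e' A"
proof (induction A arbitrary: e e')
  case (Eq s t)
  then have "dn e s = dn e' s" "dn e t = dn e' t"
    by (intro den_cong; simp)+
  then show ?case by simp
next
  case (Imp A B)
  have "sat e A = sat e' A" "sat e B = sat e' B"
    using Imp.prems by - (rule Imp.IH, simp)+
  then show ?case by simp
next
  case (Conj A B)
  have "sat e A = sat e' A" "sat e B = sat e' B"
    using Conj.prems by - (rule Conj.IH, simp)+
  then show ?case by simp
next
  case (Disj A B)
  have "sat e A = sat e' A" "sat e B = sat e' B"
    using Disj.prems by - (rule Disj.IH, simp)+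
  then show ?case by simp
next
  case (Forall v A)
  have "sat (e(v := a)) A = sat (e'(v := a)) A" for a
    using Forall.prems by (intro Forall.IH) auto
  then show ?case by simp
next
  case (Exists v A)
  have "sat (e(v := a)) A = sat (e'(v := a)) A" for a
    using Exists.prems by (intro Exists.IH) auto
  then show ?case by simp
qed simp

lemma sat_upd_fresh: "v \<notin> fv_fm A \<Longrightarrow> sat (e(v := a)) A = sat e A"
  by (rule sat_cong) auto

lemma den_subst: "dn e u = Some a \<Longrightarrow> dn e (subst_trm t v u) = dn (e(v := a)) t"
  by (induction t) auto

lemma subst_fm_fresh: "v \<notin> fv_trm t \<Longrightarrow> subst_trm t v u = t" "v \<notin> fv_fm A \<Longrightarrow> subst_fm A v u = A"
proof -
  show *: "v \<notin> fv_trm t \<Longrightarrow> subst_trm t v u = t" for t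
    by (induction t) auto
  show "v \<notin> fv_fm A \<Longrightarrow> subst_fm A v u = A"
    by (induction A) (auto simp: *)
qed

lemma sat_subst:
  "free_for u v A \<Longrightarrow> dn e u = Some a \<Longrightarrow> sat e (subst_fm A v u) = sat (e(v := a)) A"
proof (induction A arbitrary: e)
  case (Eq s t)
  then show ?case by (simp add: den_subst del: fun_upd_apply)
next
  case (Forall w A)
  show ?case
  proof (cases "v \<in> fv_fm (Forall w A)")
    case False
    show ?thesis
      by (simp only: subst_fm_fresh(2)[OF False] sat_upd_fresh[OF False])
  next
    case True
    then have w: "w \<noteq> v" "w \<notin> fv_trm u" "free_for u v A" using Forall.prems by auto
    have "dn (e(w := b)) u = Some a" for b
      using Forall.prems w by (simp add: den_upd_fresh)
    with w Forall.IH have "sat (e(w := b)) (subst_fm A v u) = sat (e(v := a, w := b)) A" for b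
      by (simp add: fun_upd_twist del: fun_upd_apply)
    with w show ?thesis by (simp del: fun_upd_apply)
  qed
next
  case (Exists w A)
  show ?case
  proof (cases "v \<in> fv_fm (Exists w A)")
    case False
    show ?thesis
      by (simp only: subst_fm_fresh(2)[OF False] sat_upd_fresh[OF False])
  next
    case True
    then have w: "w \<noteq> v" "w \<notin> fv_trm u" "free_for u v A" using Exists.prems by auto
    have "dn (e(w := b)) u = Some a" for b
      using Exists.prems w by (simp add: den_upd_fresh)
    with w Exists.IH have "sat (e(w := b)) (subst_fm A v u) = sat (e(v := a, w := b)) A" for b
      by (simp add: fun_upd_twist del: fun_upd_apply)
    with w show ?thesis by (simp del: fun_upd_apply)
  qed
qed auto

lemma finite_fv_trm: "finite (fv_trm t)"
  by (induction t) auto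

lemma fresh_notin: "finite V \<Longrightarrow> fresh V \<sigma> \<notin> V"
proof -
  assume "finite V"
  then have "\<exists>n. n \<notin> fst ` V"
    using ex_new_if_finite[OF infinite_UNIV_nat finite_imageI] by blast
  then have "(LEAST n. n \<notin> fst ` V) \<notin> fst ` V"
    by (rule LeastI_ex)
  then show ?thesis by (force simp: fresh_def)
qed

lemma snd_fresh [simp]: "snd (fresh V \<sigma>) = \<sigma>"
  by (simp add: fresh_def)

text \<open>
  The formula compares two functions on equal arguments only, whereas \<open>per\<close> compares them on related
  ones. The two agree since each of the functions respects relatedness by itself, being of the
  right type.
\<close>

lemma sat_EqAt:
  "has_type s \<sigma> \<Longrightarrow> has_type t \<sigma> \<Longrightarrow> adequate e \<Longrightarrow> dn e s = Some a \<Longrightarrow> dn e t = Some b \<Longrightarrow>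
   sat e (EqAt \<sigma> s t) \<longleftrightarrow> per \<sigma> a b"
proof (induction \<sigma> arbitrary: s t e a b)
  case TNat
  then show ?case by simp
next
  case (TFun \<rho> \<tau>)
  define v where "v = fresh (fv_trm s \<union> fv_trm t) \<rho>"
  have v: "v \<notin> fv_trm s" "v \<notin> fv_trm t" "snd v = \<rho>"
    using fresh_notin[of "fv_trm s \<union> fv_trm t" \<rho>] finite_fv_trm by (auto simp: v_def)
  have ab: "per (\<rho> \<Rrightarrow> \<tau>) a a" "per (\<rho> \<Rrightarrow> \<tau>) b b"
    using den_typed[OF TFun.prems(1,3)] den_typed[OF TFun.prems(2,3)] TFun.prems(4,5)
    by (simp_all del: per.simps)
  have sat: "sat (e(v := c)) (EqAt \<tau> (s \<cdot> Var v) (t \<cdot> Var v)) \<longleftrightarrow> per \<tau> c1 c2"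
    if "per \<rho> c c" "ap a c c1" "ap b c c2" for c c1 c2
  proof (rule TFun.IH(2))
    show "has_type (s \<cdot> Var v) \<tau>" "has_type (t \<cdot> Var v) \<tau>"
      using TFun.prems v by (auto simp: has_type_App has_type_def)
    show "adequate (e(v := c))"
      using TFun.prems v that by (simp add: adequate_upd)
    show "dn (e(v := c)) (s \<cdot> Var v) = Some c1" "dn (e(v := c)) (t \<cdot> Var v) = Some c2"
      using TFun.prems v that by (auto intro!: den_AppI simp: den_upd_fresh simp del: den.simps(7))
  qed
  have "sat e (EqAt (\<rho> \<Rrightarrow> \<tau>) s t) \<longleftrightarrow> (\<forall>c. per \<rho> c c \<longrightarrow> sat (e(v := c)) (EqAt \<tau> (s \<cdot> Var v) (t \<cdot> Var v)))"
    using v by (simp add: v_def[symmetric] Let_def)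
  also have "\<dots> \<longleftrightarrow> per (\<rho> \<Rrightarrow> \<tau>) a b"
  proof
    assume *: "\<forall>c. per \<rho> c c \<longrightarrow> sat (e(v := c)) (EqAt \<tau> (s \<cdot> Var v) (t \<cdot> Var v))"
    show "per (\<rho> \<Rrightarrow> \<tau>) a b"
      unfolding per.simps
    proof (intro allI impI)
      fix c d assume cd: "per \<rho> c d"
      then have cc: "per \<rho> c c" using per_sym per_trans by blast
      obtain u where u: "ap a c u" using ab(1) cc by (rule per_appE)
      obtain v1 v2 where v12: "ap b c v1" "ap b d v2" "per \<tau> v1 v2" using ab(2) cd by (rule per_appE)
      have "per \<tau> u v1" using sat[OF cc u v12(1)] * cc by blast
      then show "\<exists>u v. ap a c u \<and> ap b d v \<and> per \<tau> u v"
        using u v12 per_trans by blast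
    qed
  next
    assume *: "per (\<rho> \<Rrightarrow> \<tau>) a b"
    show "\<forall>c. per \<rho> c c \<longrightarrow> sat (e(v := c)) (EqAt \<tau> (s \<cdot> Var v) (t \<cdot> Var v))"
    proof (intro allI impI)
      fix c assume cc: "per \<rho> c c"
      from * cc obtain u v' where "ap a c u" "ap b c v'" "per \<tau> u v'" by (rule per_appE)
      with sat cc show "sat (e(v := c)) (EqAt \<tau> (s \<cdot> Var v) (t \<cdot> Var v))" by blast
    qed
  qed
  finally show ?case .
qed

lemma free_for_closed: "fv_trm u \<subseteq> {v} \<Longrightarrow> free_for u v A"
  by (induction A) auto

lemma has_type_apps:
  "has_type t (arrows \<sigma>s \<tau>) \<Longrightarrow> list_all2 has_type ts \<sigma>s \<Longrightarrow> has_type (apps t ts) \<tau>"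
proof (induction ts arbitrary: t \<sigma>s)
  case (Cons s ts)
  then obtain \<sigma> \<sigma>s' where "\<sigma>s = \<sigma> # \<sigma>s'" "has_type s \<sigma>" "list_all2 has_type ts \<sigma>s'"
    by (auto simp: list_all2_Cons1)
  then show ?case
    using Cons.IH[of "t \<cdot> s" \<sigma>s'] Cons.prems(1) by (auto simp: has_type_App)
qed simp

lemma dens_typed:
  assumes "list_all2 has_type ts \<sigma>s" "adequate e"
  obtains as where "list_all2 (\<lambda>t a. dn e t = Some a) ts as" "pers \<sigma>s as as"
proof -
  define as where "as = map (\<lambda>t. the (dn e t)) ts"
  have *: "dn e (ts ! j) = Some (as ! j) \<and> per (\<sigma>s ! j) (as ! j) (as ! j)" if j: "j < length ts" for j
  proof -
    have "has_type (ts ! j) (\<sigma>s ! j)"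
      using assms(1) j by (simp add: list_all2_conv_all_nth)
    then obtain a where "dn e (ts ! j) = Some a" "per (\<sigma>s ! j) a a"
      using den_typed assms(2) by blast
    then show ?thesis using j by (simp add: as_def)
  qed
  have len: "length as = length ts" "length \<sigma>s = length ts"
    using assms(1) by (auto simp: as_def list_all2_lengthD)
  show thesis
  proof (rule that)
    show "list_all2 (\<lambda>t a. dn e t = Some a) ts as"
      using * len by (simp add: list_all2_conv_all_nth)
    show "pers \<sigma>s as as" using * len by simp
  qed
qed

lemma sat_EqAt_same:
  assumes "has_type s \<sigma>" "has_type t \<sigma>" "adequate e" "dn e s = dn e t"
  shows "sat e (EqAt \<sigma> s t)"
  using den_typed[OF assms(1,3)] assms(4) sat_EqAt[OF assms(1-3)] by auto

lemma has_type_CRec_apps: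
  assumes "i < length \<rho>s" "has_type x TNat" "list_all2 has_type ys \<rho>s"
    "list_all2 has_type zs (step_types \<rho>s)"
  shows "has_type (apps (CRec \<rho>s i) (x # ys @ zs)) (\<rho>s ! i)"
proof (rule has_type_apps)
  show "has_type (CRec \<rho>s i) (arrows (TNat # \<rho>s @ step_types \<rho>s) (\<rho>s ! i))"
    using assms by (simp add: has_type_def)
  show "list_all2 has_type (x # ys @ zs) (TNat # \<rho>s @ step_types \<rho>s)"
    using assms by (auto intro: list_all2_appendI)
qed

lemma den_CRec_apps:
  assumes "i < length \<rho>s" "dn e x = Some n"
    and ys: "list_all2 (\<lambda>t a. dn e t = Some a) ys as" "pers \<rho>s as as"
    and zs: "list_all2 (\<lambda>t a. dn e t = Some a) zs bs" "pers (step_types \<rho>s) bs bs"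
  shows "dn e (apps (CRec \<rho>s i) (x # ys @ zs)) = Some (recseq as bs n ! i)"
proof (rule den_appsI)
  show "aps (rec_code (length \<rho>s) i) (n # as @ bs) (recseq as bs n ! i)"
    using aps_recseq(1) assms by blast
  show "list_all2 (\<lambda>s b. dn e s = Some b) (x # ys @ zs) (n # as @ bs)"
    using assms by (auto intro: list_all2_appendI)
qed simp

text \<open>
  Extensionality holds because every code of a functional respects \<open>per\<close>, and full induction because
  the objects of type 0 are the standard numbers. The defining equations of the constants hold
  because both sides even have the same code as value.
\<close>

theorem soundness: "EPA A \<Longrightarrow> adequate e \<Longrightarrow> sat e A"
proof (induction arbitrary: e rule: EPA.induct)
  case (forallE A t v)
  then obtain a where "dn e t = Some a" "per (snd v) a a" using den_typed by blast
  with forallE show ?case by (simp add: sat_subst)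
next
  case (existsI A t v)
  then obtain a where "dn e t = Some a" "per (snd v) a a" using den_typed by blast
  with existsI show ?case by (auto simp: sat_subst)
next
  case (forallI B A v)
  have "sat (e(v := a)) A" if "sat e B" "per (snd v) a a" for a
    using forallI.IH[of "e(v := a)"] forallI.hyps forallI.prems that
    by (simp add: adequate_upd sat_upd_fresh del: fun_upd_apply)
  then show ?case by simp
next
  case (existsE A B v)
  have "sat e B" if "sat (e(v := a)) A" "per (snd v) a a" for a
    using existsE.IH[of "e(v := a)"] existsE.hyps existsE.prems that
    by (simp add: adequate_upd sat_upd_fresh del: fun_upd_apply)
  then show ?case by auto
next
  case (extensionality z \<rho> \<tau> s t)
  obtain f a b where d: "dn e z = Some f" "per (\<rho> \<Rrightarrow> \<tau>) f f" "dn e s = Some a" "dn e t = Some b"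
    using extensionality den_typed by meson
  have "sat e (EqAt \<tau> (z \<cdot> s) (z \<cdot> t))" if "sat e (EqAt \<rho> s t)"
  proof -
    have "per \<rho> a b"
      using that sat_EqAt[OF extensionality(2,3,4) d(3,4)] by blast
    with d(2) obtain u v where "ap f a u" "ap f b v" "per \<tau> u v" by (rule per_appE)
    moreover have "has_type (z \<cdot> s) \<tau>" "has_type (z \<cdot> t) \<tau>"
      using extensionality by (auto simp: has_type_App)
    ultimately show ?thesis
      using sat_EqAt extensionality.prems den_AppI d by blast
  qed
  then show ?case by simp
next
  case (suc_nonzero s)
  then obtain a where "dn e s = Some a" using den_typed by blast
  then have "dn e (CSuc \<cdot> s) = Some (Suc a)" using ap_suc by (auto intro: den_AppI simp del: den.simps(7))
  then show ?case by (simp del: den.simps(7))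
next
  case (suc_inject s t)
  then obtain a b where ab: "dn e s = Some a" "dn e t = Some b" using den_typed by blast
  then have "dn e (CSuc \<cdot> s) = Some (Suc a)" "dn e (CSuc \<cdot> t) = Some (Suc b)"
    using ap_suc by (auto intro: den_AppI simp del: den.simps(7))
  with ab show ?case by (simp del: den.simps(7))
next
  case (induction A v)
  have suc: "sat (e(v := n)) (subst_fm A v (CSuc \<cdot> Var v)) = sat (e(v := Suc n)) A" for n
  proof -
    have "dn (e(v := n)) (CSuc \<cdot> Var v) = Some (Suc n)"
      using ap_suc by (auto intro: den_AppI simp del: den.simps(7))
    then have "sat (e(v := n)) (subst_fm A v (CSuc \<cdot> Var v)) = sat (e(v := n, v := Suc n)) A"
      by (intro sat_subst free_for_closed) simp_all
    then show ?thesis by simp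
  qed
  have zero: "sat e (subst_fm A v CZero) = sat (e(v := 0)) A"
    by (intro sat_subst free_for_closed) simp_all
  have "sat (e(v := n)) A" if "sat (e(v := 0)) A" "\<And>n. sat (e(v := n)) A \<Longrightarrow> sat (e(v := Suc n)) A" for n
    using that by (induction n) blast+
  then show ?case using \<open>snd v = TNat\<close> by (simp add: suc zero)
next
  case (Pi_eq s \<rho> t \<tau>)
  then obtain a b where "dn e s = Some a" "dn e t = Some b" using den_typed by blast
  then have "dn e (CPi \<rho> \<tau> \<cdot> s \<cdot> t) = dn e s"
    using Lam_constant ap_rec_zero den_AppI by metis
  moreover have "has_type (CPi \<rho> \<tau> \<cdot> s \<cdot> t) \<rho>"
    using Pi_eq by (simp add: has_type_def)
  ultimately show ?case using Pi_eq sat_EqAt_same by blast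
next
  case (Sigma_eq s \<delta> \<rho> \<tau> t u)
  then have ty: "has_type (CSigma \<delta> \<rho> \<tau> \<cdot> s \<cdot> t \<cdot> u) \<tau>" "has_type (s \<cdot> u \<cdot> (t \<cdot> u)) \<tau>"
    by (simp_all add: has_type_def)
  obtain a b c w where d: "dn e s = Some a" "dn e t = Some b" "dn e u = Some c"
      "dn e (s \<cdot> u \<cdot> (t \<cdot> u)) = Some w"
    using Sigma_eq den_typed ty(2) by meson
  then obtain p q where "ap a c p" "ap b c q" "ap p q w"
    unfolding den_App_eq_Some by auto
  then have "dn e (CSigma \<delta> \<rho> \<tau> \<cdot> s \<cdot> t \<cdot> u) = Some w"
    using den_AppI[OF den_Sigma[OF d(1,2)] d(3)] ap_S by blast
  then show ?case using sat_EqAt_same[OF ty Sigma_eq.prems] d(4) by simp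
next
  case (Rec_zero i \<rho>s ys zs)
  obtain as where as: "list_all2 (\<lambda>t a. dn e t = Some a) ys as" "pers \<rho>s as as"
    using dens_typed Rec_zero by blast
  obtain bs where bs: "list_all2 (\<lambda>t a. dn e t = Some a) zs bs" "pers (step_types \<rho>s) bs bs"
    using dens_typed Rec_zero by blast
  show ?case
  proof (rule sat_EqAt_same)
    show "has_type (apps (CRec \<rho>s i) (CZero # ys @ zs)) (\<rho>s ! i)"
      using Rec_zero by (intro has_type_CRec_apps) (simp_all add: has_type_def)
    show "has_type (ys ! i) (\<rho>s ! i)"
      using Rec_zero by (simp add: list_all2_conv_all_nth)
    have "dn e (apps (CRec \<rho>s i) (CZero # ys @ zs)) = Some (as ! i)"
      using den_CRec_apps[OF Rec_zero.hyps(1) _ as bs, of CZero 0] by simp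
    then show "dn e (apps (CRec \<rho>s i) (CZero # ys @ zs)) = dn e (ys ! i)"
      using as Rec_zero.hyps(1) by (simp add: list_all2_conv_all_nth)
  qed (rule Rec_zero.prems)
next
  case (Rec_suc i \<rho>s x ys zs)
  let ?k = "length \<rho>s"
  let ?rs = "map (\<lambda>j. apps (CRec \<rho>s j) (x # ys @ zs)) [0..<?k]"
  obtain n where n: "dn e x = Some n" using den_typed Rec_suc by blast
  obtain as where as: "list_all2 (\<lambda>t a. dn e t = Some a) ys as" "pers \<rho>s as as"
    using dens_typed Rec_suc by blast
  obtain bs where bs: "list_all2 (\<lambda>t a. dn e t = Some a) zs bs" "pers (step_types \<rho>s) bs bs"
    using dens_typed Rec_suc by blast
  note per = per_recseq[OF as(2) bs(2), of n]
  show ?case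
  proof (rule sat_EqAt_same)
    show "has_type (apps (CRec \<rho>s i) ((CSuc \<cdot> x) # ys @ zs)) (\<rho>s ! i)"
      using Rec_suc by (intro has_type_CRec_apps) (simp_all add: has_type_def)
    show "has_type (apps (zs ! i) (?rs @ [x])) (\<rho>s ! i)"
    proof (rule has_type_apps)
      show "has_type (zs ! i) (arrows (\<rho>s @ [TNat]) (\<rho>s ! i))"
        using list_all2_nthD2[OF Rec_suc.hyps(4), of i] Rec_suc.hyps(1) by simp
      show "list_all2 has_type (?rs @ [x]) (\<rho>s @ [TNat])"
        using Rec_suc has_type_CRec_apps by (intro list_all2_appendI) (auto simp: list_all2_conv_all_nth)
    qed
    have "dn e (CSuc \<cdot> x) = Some (Suc n)"
      by (rule den_AppI[OF _ n ap_suc]) simp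
    then have "dn e (apps (CRec \<rho>s i) ((CSuc \<cdot> x) # ys @ zs)) = Some (recseq as bs (Suc n) ! i)"
      using den_CRec_apps[OF Rec_suc.hyps(1) _ as bs] by blast
    moreover have "dn e (apps (zs ! i) (?rs @ [x])) = Some (recseq as bs (Suc n) ! i)"
    proof (rule den_appsI)
      show "dn e (zs ! i) = Some (bs ! i)"
        using bs Rec_suc.hyps(1) by (simp add: list_all2_conv_all_nth)
      show "aps (bs ! i) (recseq as bs n @ [n]) (recseq as bs (Suc n) ! i)"
        by (rule recseq_step(1)[OF bs(2) per Rec_suc.hyps(1)])
      have "dn e (apps (CRec \<rho>s j) (x # ys @ zs)) = Some (recseq as bs n ! j)" if "j < ?k" for j
        using den_CRec_apps[OF that n as bs] .
      then show "list_all2 (\<lambda>s b. dn e s = Some b) (?rs @ [x]) (recseq as bs n @ [n])"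
        using per n by (intro list_all2_appendI) (simp_all add: list_all2_conv_all_nth del: foldl_Cons)
    qed
    ultimately show "dn e (apps (CRec \<rho>s i) ((CSuc \<cdot> x) # ys @ zs)) = dn e (apps (zs ! i) (?rs @ [x]))"
      by simp
  qed (rule Rec_suc.prems)
next
  case (eq_trans s t u)
  then show ?case by (simp del: den.simps)
qed (auto simp del: den.simps)

section \<open>Membership in coded sequences\<close>

declare den.simps(7) [simp del]

lemma den_App_papp: "dn e t = Some u \<Longrightarrow> dn e (t \<cdot> s) = Option.bind (dn e s) (papp u)"
  by (simp add: den.simps(7))

text \<open>
  The equation is required also where the argument has no value, which makes it an unconditional
  rewrite rule.
\<close>

definition computes :: "trm \<Rightarrow> (nat \<Rightarrow> nat) \<Rightarrow> bool" where
  "computes t F \<longleftrightarrow> (\<forall>e s. dn e (t \<cdot> s) = map_option F (dn e s))"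

lemma den_App_total:
  assumes "dn e t = Some u" "\<And>n. ap u n (F n)"
  shows "dn e (t \<cdot> s) = map_option F (dn e s)"
  using assms by (cases "dn e s") (simp_all add: den_App_papp papp_eq_Some)

lemma den_Suc [simp]: "dn e (CSuc \<cdot> s) = map_option Suc (dn e s)"
  by (rule den_App_total) (auto intro: ap_suc)

lemma computes_Lam:
  assumes "\<And>e n. dn (e(v := n)) t = Some (F n)"
  shows "computes (Lam v t) F"
  unfolding computes_def
proof (intro allI)
  fix e s
  have *: "\<exists>u. dn e (Lam v t) = Some u \<and> ap u n (F n)" for n
    by (rule Lam_beta) (rule assms)
  then obtain u where u: "dn e (Lam v t) = Some u" by blast
  then have "ap u n (F n)" for n using * by auto
  with u show "dn e (Lam v t \<cdot> s) = map_option F (dn e s)" by (rule den_App_total)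
qed

lemma den_Lams:
  assumes "\<And>as. length as = length vs \<Longrightarrow> dn (upds e vs as) t = Some (F as)"
  shows "\<exists>s. dn e (Lams vs t) = Some s \<and> (\<forall>as. length as = length vs \<longrightarrow> aps s as (F as))"
proof -
  have *: "\<exists>p. dn e (Lams vs t) = Some p \<and> aps p as (F as)" if "length as = length vs" for as
    using Lams_beta that assms by blast
  then obtain s where s: "dn e (Lams vs t) = Some s"
    by (meson length_replicate)
  with * have "aps s as (F as)" if "length as = length vs" for as
    using that by auto
  with s show ?thesis by blast
qed

lemma den_Lam2:
  assumes "\<And>a b. dn (e(v := a, w := b)) t = Some (F a b)"
  obtains s where "dn e (Lam2 v w t) = Some s" "\<And>a b. aps s [a, b] (F a b)"
proof -
  have "dn (upds e [v, w] as) t = Some (F (as ! 0) (as ! 1))" if "length as = length [v, w]" for as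
    using that assms by (auto simp: length_Suc_conv simp del: fun_upd_apply)
  from den_Lams[where F = "\<lambda>as. F (as ! 0) (as ! 1)", OF this]
  obtain s where "dn e (Lams [v, w] t) = Some s"
      "\<forall>as. length as = length [v, w] \<longrightarrow> aps s as (F (as ! 0) (as ! 1))"
    by blast
  from this(1) this(2)[rule_format, of "[_, _]"] show thesis by (intro that) simp_all
qed

lemma den_Lam3:
  assumes "\<And>a b c. dn (e(u := a, v := b, w := c)) t = Some (F a b c)"
  obtains s where "dn e (Lam3 u v w t) = Some s" "\<And>a b c. aps s [a, b, c] (F a b c)"
proof -
  have "dn (upds e [u, v, w] as) t = Some (F (as ! 0) (as ! 1) (as ! 2))"
    if "length as = length [u, v, w]" for as
    using that assms by (auto simp: length_Suc_conv simp del: fun_upd_apply)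
  from den_Lams[where F = "\<lambda>as. F (as ! 0) (as ! 1) (as ! 2)", OF this]
  obtain s where "dn e (Lams [u, v, w] t) = Some s"
      "\<forall>as. length as = length [u, v, w] \<longrightarrow> aps s as (F (as ! 0) (as ! 1) (as ! 2))"
    by blast
  from this(1) this(2)[rule_format, of "[_, _, _]"] show thesis by (intro that) simp_all
qed

lemma den_rec:
  assumes "dn e x = Some n" "dn e y = Some (f 0)" "dn e z = Some s"
    and "\<And>n. aps s [f n, n] (f (Suc n))"
  shows "dn e (CRec [TNat] 0 \<cdot> x \<cdot> y \<cdot> z) = Some (f n)"
proof -
  have "aps (rec_code 1 0) (n # [f 0] @ [s]) ([f n] ! 0)"
    by (rule aps_rec_code) (use assms in auto)
  then have "dn e (apps (CRec [TNat] 0) [x, y, z]) = Some (f n)"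
    using assms by (intro den_appsI[of _ _ _ "rec_code 1 0" _ "[n, f 0, s]"]) auto
  then show ?thesis by simp
qed

lemma den_ifzT:
  assumes "dn e x = Some n" "dn e a = Some p" "dn e b = Some q"
  shows "dn e (ifzT \<cdot> x \<cdot> a \<cdot> b) = Some (if n = 0 then p else q)"
proof -
  have "dn (e(nv 0 := n, nv 1 := p, nv 2 := q))
      (apps (CRec [TNat] 0) [Var (nv 0), Var (nv 1), Lam2 (nv 3) (nv 4) (Var (nv 2))])
    = Some (if n = 0 then p else q)" (is "dn ?e _ = _") for n p q
  proof -
    have "dn (?e(nv 3 := c, nv 4 := d)) (Var (nv 2)) = Some q" for c d
      by simp
    then obtain s where s: "dn ?e (Lam2 (nv 3) (nv 4) (Var (nv 2))) = Some s" "\<And>c d. aps s [c, d] q"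
      by (rule den_Lam2[where F = "\<lambda>_ _. q"]) blast
    show ?thesis
      unfolding foldl.simps by (rule den_rec[OF _ _ s(1)]) (use s(2) in auto)
  qed
  then obtain s where "dn e ifzT = Some s" "\<And>n p q. aps s [n, p, q] (if n = 0 then p else q)"
    unfolding ifzT_def by (rule den_Lam3[where F = "\<lambda>n p q. if n = 0 then p else q"]) blast
  then have "dn e (apps ifzT [x, a, b]) = Some (if n = 0 then p else q)"
    using assms by (intro den_appsI[of _ _ _ s _ "[n, p, q]"]) simp_all
  then show ?thesis by simp
qed

lemma computes_predT: "computes predT (\<lambda>n. n - 1)"
  unfolding predT_def
proof (rule computes_Lam)
  fix e :: "var \<Rightarrow> nat" and n
  let ?e = "e(nv 0 := n)"
  have "dn (?e(nv 1 := c, nv 2 := d)) (Var (nv 2)) = Some d" for c d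
    by simp
  then obtain s where s: "dn ?e (Lam2 (nv 1) (nv 2) (Var (nv 2))) = Some s" "\<And>c d. aps s [c, d] d"
    by (rule den_Lam2[where F = "\<lambda>_ d. d"]) blast
  show "dn ?e (apps (CRec [TNat] 0) [Var (nv 0), CZero, Lam2 (nv 1) (nv 2) (Var (nv 2))]) = Some (n - 1)"
    unfolding foldl.simps by (rule den_rec[OF _ _ s(1)]) (use s(2) in auto)
qed

text \<open>
  The recursion by which \<open>unpairT\<close> is defined: it walks through the diagonals of Cantor's
  enumeration.
\<close>

lemma prod_decode_Suc:
  "prod_decode (Suc n) =
   (if rgt n = 0 then (0, Suc (lft n)) else (Suc (lft n), rgt n - 1))"
proof -
  obtain a b where ab: "prod_decode n = (a, b)" by (cases "prod_decode n")
  then have "Suc n = Suc (pr a b)" by (metis prod_decode_inverse)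
  also have "\<dots> = prod_encode (if b = 0 then (0, Suc a) else (Suc a, b - 1))"
    by (cases b) (simp_all add: prod_encode_def)
  finally show ?thesis using ab by simp
qed

lemma prod_decode_0: "prod_decode 0 = (0, 0)"
proof -
  have "prod_decode (pr 0 0) = (0, 0)" by (rule prod_encode_inverse)
  then show ?thesis by (simp add: prod_encode_def)
qed

lemma computes_unpairT: "computes (unpairT 0) lft" "computes (unpairT 1) rgt"
proof -
  define Z0 where "Z0 = Lam3 (nv 1) (nv 2) (nv 3) (ifzT \<cdot> Var (nv 2) \<cdot> CZero \<cdot> (CSuc \<cdot> Var (nv 1)))"
  define Z1 where "Z1 = Lam3 (nv 1) (nv 2) (nv 3)
    (ifzT \<cdot> Var (nv 2) \<cdot> (CSuc \<cdot> Var (nv 1)) \<cdot> (predT \<cdot> Var (nv 2)))"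
  have "dn (e(nv 0 := n)) (apps (CRec [TNat, TNat] i) [Var (nv 0), CZero, CZero, Z0, Z1])
    = Some ([lft n, rgt n] ! i)" if i: "i < 2" for i n e
  proof -
    let ?e = "e(nv 0 := n)"
    have "dn (?e(nv 1 := a, nv 2 := b, nv 3 := c))
        (ifzT \<cdot> Var (nv 2) \<cdot> CZero \<cdot> (CSuc \<cdot> Var (nv 1))) = Some (if b = 0 then 0 else Suc a)" for a b c
      by (rule den_ifzT) simp_all
    then obtain s0 where s0: "dn ?e Z0 = Some s0" "\<And>a b c. aps s0 [a, b, c] (if b = 0 then 0 else Suc a)"
      unfolding Z0_def by (rule den_Lam3[where F = "\<lambda>a b c. if b = 0 then 0 else Suc a"]) blast
    have "dn (?e(nv 1 := a, nv 2 := b, nv 3 := c))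
        (ifzT \<cdot> Var (nv 2) \<cdot> (CSuc \<cdot> Var (nv 1)) \<cdot> (predT \<cdot> Var (nv 2)))
        = Some (if b = 0 then Suc a else b - 1)" for a b c
      by (rule den_ifzT) (simp_all add: computes_predT[unfolded computes_def])
    then obtain s1 where s1: "dn ?e Z1 = Some s1" "\<And>a b c. aps s1 [a, b, c] (if b = 0 then Suc a else b - 1)"
      unfolding Z1_def by (rule den_Lam3[where F = "\<lambda>a b c. if b = 0 then Suc a else b - 1"]) blast
    have "aps (rec_code 2 i) (n # [0, 0] @ [s0, s1]) ([lft n, rgt n] ! i)"
    proof (rule aps_rec_code[OF i])
      fix m j :: nat assume "j < 2"
      then show "aps ([s0, s1] ! j) ([lft m, rgt m] @ [m]) ([lft (Suc m), rgt (Suc m)] ! j)"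
        using s0(2)[of "lft m" "rgt m" m] s1(2)[of "lft m" "rgt m" m]
        by (auto simp: less_2_cases_iff prod_decode_Suc simp del: aps.simps)
    qed (simp_all add: prod_decode_0)
    then show ?thesis
      using s0(1) s1(1) by (intro den_appsI[of _ _ _ "rec_code 2 i" _ "[n, 0, 0, s0, s1]"])
        (simp_all del: aps.simps add: numeral_2_eq_2)
  qed
  then have "computes (unpairT i) (\<lambda>n. [lft n, rgt n] ! i)" if "i < 2" for i
    unfolding unpairT_def Let_def Z0_def[symmetric] Z1_def[symmetric]
    using that by (intro computes_Lam) blast
  from this[of 0] this[of 1] show "computes (unpairT 0) lft" "computes (unpairT 1) rgt"
    by simp_all
qed

lemma den_unpairT [simp]:
  "dn e (unpairT 0 \<cdot> s) = map_option lft (dn e s)"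
  "dn e (unpairT (Suc 0) \<cdot> s) = map_option rgt (dn e s)"
  using computes_unpairT by (simp_all add: computes_def)

lemma den_predT [simp]: "dn e (predT \<cdot> s) = map_option (\<lambda>n. n - 1) (dn e s)"
  using computes_predT by (simp add: computes_def)

definition tail :: "nat \<Rightarrow> nat" where "tail c = rgt (c - 1)"

lemma den_hdT: "dn e (hdT \<cdot> s) = map_option (\<lambda>c. lft (c - 1)) (dn e s)"
  using computes_Lam[of "nv 0" "unpairT 0 \<cdot> (predT \<cdot> Var (nv 0))"] by (simp add: computes_def hdT_def)

lemma den_tlT: "dn e (tlT \<cdot> s) = map_option tail (dn e s)"
  using computes_Lam[of "nv 0" "unpairT 1 \<cdot> (predT \<cdot> Var (nv 0))" tail] by (simp add: computes_def tlT_def tail_def)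

lemma den_dropT:
  assumes "dn e s = Some i" "dn e t = Some c"
  shows "dn e (dropT \<cdot> s \<cdot> t) = Some ((tail ^^ i) c)"
proof -
  have "dn (e(nv 0 := i, nv 1 := c))
      (apps (CRec [TNat] 0) [Var (nv 0), Var (nv 1), Lam2 (nv 2) (nv 3) (tlT \<cdot> Var (nv 2))])
    = Some ((tail ^^ i) c)" (is "dn ?e _ = _") for i c
  proof -
    have "dn (?e(nv 2 := a, nv 3 := b)) (tlT \<cdot> Var (nv 2)) = Some (tail a)" for a b
      by (simp add: den_tlT)
    then obtain s where s: "dn ?e (Lam2 (nv 2) (nv 3) (tlT \<cdot> Var (nv 2))) = Some s" "\<And>a b. aps s [a, b] (tail a)"
      by (rule den_Lam2[where F = "\<lambda>a _. tail a"]) blast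
    show ?thesis
      unfolding foldl.simps by (rule den_rec[OF _ _ s(1)]) (use s(2) in \<open>simp_all del: aps.simps\<close>)
  qed
  then obtain s' where "dn e dropT = Some s'" "\<And>i c. aps s' [i, c] ((tail ^^ i) c)"
    unfolding dropT_def by (rule den_Lam2[where F = "\<lambda>i c. (tail ^^ i) c"]) blast
  then have "dn e (apps dropT [s, t]) = Some ((tail ^^ i) c)"
    using assms by (intro den_appsI[of _ _ _ s' _ "[i, c]"]) (simp_all del: aps.simps)
  then show ?thesis by simp
qed

definition members :: "nat \<Rightarrow> nat set" where
  "members c = {y. \<exists>i. (tail ^^ i) c \<noteq> 0 \<and> y = lft ((tail ^^ i) c - 1)}"

text \<open>
  \<open>tail\<close> decreases positive codes, so that after \<open>c\<close> steps nothing is left of the sequence.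
\<close>

lemma finite_members: "finite (members c)"
proof -
  have tail: "tail c \<le> c - 1" for c
    by (metis le_prod_encode_2 prod.collapse prod_decode_inverse tail_def)
  have "(tail ^^ i) c \<le> c - i" for i
  proof (induction i)
    case (Suc i)
    have "tail ((tail ^^ i) c) \<le> (tail ^^ i) c - 1" by (rule tail)
    also have "\<dots> \<le> c - Suc i" using Suc.IH by simp
    finally show ?case by simp
  qed simp
  then have "(tail ^^ i) c \<noteq> 0 \<Longrightarrow> i < c" for i
    by (metis diff_is_0_eq le_zero_eq not_less)
  then have "members c \<subseteq> (\<lambda>i. lft ((tail ^^ i) c - 1)) ` {..<c}"
    by (auto simp: members_def)
  then show ?thesis by (rule finite_subset) simp
qed

lemma sat_InSeq:
  assumes "dn e s = Some y" "dn e t = Some c"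
  shows "sat e (InSeq s t) \<longleftrightarrow> y \<in> members c"
proof -
  define v where "v = fresh (fv_trm s \<union> fv_trm t) TNat"
  have v: "v \<notin> fv_trm s" "v \<notin> fv_trm t" "snd v = TNat"
    using fresh_notin[of "fv_trm s \<union> fv_trm t"] finite_fv_trm by (auto simp: v_def)
  have drop: "dn (e(v := i)) (dropT \<cdot> Var v \<cdot> t) = Some ((tail ^^ i) c)" for i
    by (rule den_dropT) (use assms v in \<open>simp_all add: den_upd_fresh del: fun_upd_apply\<close>, simp)
  have "sat e (InSeq s t) \<longleftrightarrow> (\<exists>i. sat (e(v := i)) (Conj (Neg (Eq (dropT \<cdot> Var v \<cdot> t) CZero))
      (Eq s (hdT \<cdot> (dropT \<cdot> Var v \<cdot> t)))))"
    using v(3) by (simp add: InSeq_def v_def[symmetric] Let_def del: fun_upd_apply)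
  also have "\<dots> \<longleftrightarrow> y \<in> members c"
    using v assms by (simp add: drop den_hdT den_upd_fresh members_def del: fun_upd_apply)
  finally show ?thesis .
qed

lemma fv_InSeq: "fv_fm (InSeq s t) = fv_trm s \<union> fv_trm t"
  using fresh_notin[of "fv_trm s \<union> fv_trm t" TNat] finite_fv_trm
  by (auto simp: InSeq_def Let_def closed_decoding_terms)

lemma wf_InSeq: "has_type s TNat \<Longrightarrow> has_type t TNat \<Longrightarrow> wf_fm (InSeq s t)"
  using closed_decoding_terms by (simp add: InSeq_def Let_def has_type_def)

section \<open>Derivations of application facts\<close>

text \<open>
  One application of a rule of \<open>ap\<close> with premises from \<open>X\<close>. The rules are inverted here: components
  are obtained by decoding, as the terms of the language do it, instead of by matching against
  pairs.
\<close>

definition ap_step :: "(nat \<Rightarrow> nat \<Rightarrow> nat \<Rightarrow> bool) \<Rightarrow> nat \<Rightarrow> nat \<Rightarrow> nat \<Rightarrow> bool" where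
  "ap_step X a b c \<longleftrightarrow>
     (lft a = 0 \<and> c = Suc b) \<or>
     (lft a = 2 \<and> lft c = 3 \<and> lft (rgt c) = rgt a \<and> rgt (rgt c) = b) \<or>
     (lft a = 3 \<and> lft c = lft (rgt a) \<and> lft (rgt c) = rgt (rgt a) \<and> rgt (rgt c) = b) \<or>
     (lft a = 4 \<and> (\<exists>u v. X (lft (rgt a)) b u \<and> X (rgt (rgt a)) b v \<and> X u v c)) \<or>
     (lft a = 5 \<and> lft (rgt a) = 0 \<and> c = rgt (rgt a)) \<or>
     (lft a = 5 \<and> (\<exists>m w u v. lft (rgt a) = Suc m \<and>
        lft w = 5 \<and> lft (rgt w) = m \<and> rgt (rgt w) = rgt (rgt a) \<and>
        X w b u \<and> X b u v \<and> X v m c))"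

lemma prod_decode_eq_iff: "lft n = a \<and> rgt n = b \<longleftrightarrow> n = pr a b"
  by (metis prod.collapse prod_decode_inverse prod_encode_inverse fst_conv snd_conv)

lemma ap_step_mono: "ap_step X a b c \<Longrightarrow> (\<And>a b c. X a b c \<Longrightarrow> Y a b c) \<Longrightarrow> ap_step Y a b c"
  unfolding ap_step_def by blast

lemma ap_step_sound:
  assumes step: "ap_step X a b c" and X: "\<And>a b c. X a b c \<Longrightarrow> ap a b c"
  shows "ap a b c"
proof -
  have ex: "\<exists>t p q. n = pr t (pr p q)" for n
    by (metis prod_decode_eq_iff)
  obtain t p q where a: "a = pr t (pr p q)" using ex by blast
  obtain s x y where c: "c = pr s (pr x y)" using ex by blast
  from step consider "t = 0" "c = Suc b" | "t = 2" "c = pr 3 (pr (pr p q) b)"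
    | "t = 3" "c = pr p (pr q b)" | u v where "t = 4" "X p b u" "X q b v" "X u v c"
    | "t = 5" "p = 0" "c = q"
    | m w u v where "t = 5" "p = Suc m" "w = pr 5 (pr m q)" "X w b u" "X b u v" "X v m c"
    unfolding ap_step_def a by (auto simp: prod_decode_eq_iff[symmetric])
  then show ?thesis
    unfolding a
    by cases (auto intro: ap_suc ap_curry ap_collect ap_S ap_rec_zero ap_rec_suc dest: X)
qed

definition derivation :: "(nat \<times> nat \<times> nat) list \<Rightarrow> bool" where
  "derivation l \<longleftrightarrow> (\<forall>i<length l. \<forall>a b c. l ! i = (a, b, c) \<longrightarrow>
     ap_step (\<lambda>a b c. (a, b, c) \<in> set (take i l)) a b c)"

lemma derivation_append:
  assumes "derivation l" "derivation l'"
  shows "derivation (l @ l')"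
  unfolding derivation_def
proof (intro allI impI)
  fix i a b c
  assume i: "i < length (l @ l')" and t: "(l @ l') ! i = (a, b, c)"
  show "ap_step (\<lambda>a b c. (a, b, c) \<in> set (take i (l @ l'))) a b c"
  proof (cases "i < length l")
    case True
    then show ?thesis using assms(1) t by (simp add: derivation_def nth_append)
  next
    case False
    then have "ap_step (\<lambda>a b c. (a, b, c) \<in> set (take (i - length l) l')) a b c"
      using assms(2) t i by (simp add: derivation_def nth_append)
    then show ?thesis by (rule ap_step_mono) (simp add: False)
  qed
qed

lemma derivation_snoc:
  assumes "derivation l" "ap_step (\<lambda>a b c. (a, b, c) \<in> set l) a b c"
  shows "derivation (l @ [(a, b, c)])"
  using assms by (auto simp: derivation_def nth_append less_Suc_eq)

text \<open>
  Derivations can be concatenated, so those of the premises of a rule are followed by its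
  conclusion.
\<close>

lemma ap_derivation: "ap a b c \<Longrightarrow> \<exists>l. derivation l \<and> (a, b, c) \<in> set l"
proof (induction rule: ap.induct)
  case (ap_suc p b)
  have "derivation ([] @ [(pr 0 p, b, Suc b)])"
    by (rule derivation_snoc) (auto simp: derivation_def ap_step_def)
  then show ?case by fastforce
next
  case (ap_curry t b)
  have "derivation ([] @ [(pr 2 t, b, pr 3 (pr t b))])"
    by (rule derivation_snoc) (auto simp: derivation_def ap_step_def)
  then show ?case by fastforce
next
  case (ap_collect t p b)
  have "derivation ([] @ [(pr 3 (pr t p), b, pr t (pr p b))])"
    by (rule derivation_snoc) (auto simp: derivation_def ap_step_def)
  then show ?case by fastforce
next
  case (ap_S p b u q v c)
  then obtain l1 l2 l3 where l: "derivation l1" "(p, b, u) \<in> set l1"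
    "derivation l2" "(q, b, v) \<in> set l2" "derivation l3" "(u, v, c) \<in> set l3" by blast
  then have "derivation ((l1 @ l2 @ l3) @ [(pr 4 (pr p q), b, c)])"
    by (intro derivation_snoc derivation_append) (auto simp: ap_step_def)
  then show ?case by fastforce
next
  case (ap_rec_zero y b)
  have "derivation ([] @ [(pr 5 (pr 0 y), b, y)])"
    by (rule derivation_snoc) (auto simp: derivation_def ap_step_def)
  then show ?case by fastforce
next
  case (ap_rec_suc m y b u v c)
  then obtain l1 l2 l3 where l: "derivation l1" "(pr 5 (pr m y), b, u) \<in> set l1"
    "derivation l2" "(b, u, v) \<in> set l2" "derivation l3" "(v, m, c) \<in> set l3" by blast
  have "ap_step (\<lambda>a b c. (a, b, c) \<in> set (l1 @ l2 @ l3)) (pr 5 (pr (Suc m) y)) b c"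
    unfolding ap_step_def using l
    by (intro HOL.disjI2 HOL.conjI exI[of _ m] exI[of _ "pr 5 (pr m y)"] exI[of _ u] exI[of _ v]) auto
  with l have "derivation ((l1 @ l2 @ l3) @ [(pr 5 (pr (Suc m) y), b, c)])"
    by (intro derivation_snoc derivation_append)
  then show ?case by fastforce
qed

definition total :: "nat \<Rightarrow> bool" where "total a \<longleftrightarrow> (\<forall>n. \<exists>c. ap a n c)"

definition fn :: "nat \<Rightarrow> nat \<Rightarrow> nat" where "fn a n = the (papp a n)"

lemma per_type_1: "per (TNat \<Rrightarrow> TNat) a a \<longleftrightarrow> total a"
  by (auto simp: total_def)

lemma ap_fn: "total a \<Longrightarrow> ap a n (fn a n)"
  unfolding total_def fn_def by (metis option.sel papp_eq_Some)

lemma fn_eq: "ap a n c \<Longrightarrow> fn a n = c"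
  by (simp add: fn_def flip: papp_eq_Some)

text \<open>
  The objects of type 1 include a table for every finite sequence. The case distinction on the
  argument is a recursion whose step function discards the value of the recursive call: the step
  function is the constant function with value the table \<open>t\<close> of the remaining sequence.
\<close>

lemma table_exists: "\<exists>a. total a \<and> (\<forall>i<length l. fn a i = l ! i)"
proof (induction l)
  case Nil
  have "total (pr 0 0)" using ap_suc by (auto simp: total_def)
  then show ?case by auto
next
  case (Cons x l)
  then obtain t where t: "total t" "\<And>i. i < length l \<Longrightarrow> fn t i = l ! i" by blast
  let ?b = "pr 5 (pr 0 t)"
  let ?a = "pr 4 (pr (pr 4 (pr R_code (pr 5 (pr 0 x)))) (pr 5 (pr 0 ?b)))"
  have rec: "ap (pr 5 (pr n x)) ?b (case n of 0 \<Rightarrow> x | Suc m \<Rightarrow> fn t m)" for n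
  proof (induction n)
    case 0
    show ?case by (simp add: ap_rec_zero)
  next
    case (Suc m)
    then show ?case using ap_rec_suc[OF Suc ap_rec_zero ap_fn[OF t(1)]] by simp
  qed
  have "ap (pr 4 (pr R_code (pr 5 (pr 0 x)))) n (pr 5 (pr n x))" for n
    by (rule ap_S[OF ap_curry ap_rec_zero ap_collect])
  then have a: "ap ?a n (case n of 0 \<Rightarrow> x | Suc m \<Rightarrow> fn t m)" for n
    by (rule ap_S[OF _ ap_rec_zero rec])
  then have "total ?a" unfolding total_def by blast
  moreover have "fn ?a i = (x # l) ! i" if "i < length (x # l)" for i
    using fn_eq[OF a, of i] t(2) that by (cases i) auto
  ultimately show ?case by blast
qed

abbreviation entry :: "nat \<Rightarrow> nat \<Rightarrow> nat \<Rightarrow> nat \<Rightarrow> nat \<Rightarrow> nat \<Rightarrow> nat \<Rightarrow> bool" where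
  "entry f g h i a b c \<equiv> \<exists>j<i. a = fn f j \<and> b = fn g j \<and> c = fn h j"

text \<open>
  Three functions of type 1 list the components of a derivation, in which every entry up to \<open>n\<close>
  follows by a rule from entries with smaller index; the order of the indices excludes circular
  derivations. The functions can be quantified over in the language, so no coding of finite
  sequences is needed. The case \<open>n < i\<close> exempts the irrelevant values beyond the end.
\<close>

lemma ap_iff_tables:
  "ap a b c \<longleftrightarrow> (\<exists>f g h n. total f \<and> total g \<and> total h \<and> fn f n = a \<and> fn g n = b \<and> fn h n = c \<and>
     (\<forall>i. n < i \<or> ap_step (entry f g h i) (fn f i) (fn g i) (fn h i)))" (is "_ \<longleftrightarrow> ?R")
proof
  assume "ap a b c"
  then obtain l n where l: "derivation l" "n < length l" "l ! n = (a, b, c)"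
    using ap_derivation in_set_conv_nth by metis
  obtain f where f: "total f" "\<And>i. i < length l \<Longrightarrow> fn f i = fst (l ! i)"
    using table_exists[of "map fst l"] by auto
  obtain g where g: "total g" "\<And>i. i < length l \<Longrightarrow> fn g i = fst (snd (l ! i))"
    using table_exists[of "map (fst \<circ> snd) l"] by auto
  obtain h where h: "total h" "\<And>i. i < length l \<Longrightarrow> fn h i = snd (snd (l ! i))"
    using table_exists[of "map (snd \<circ> snd) l"] by auto
  have "ap_step (entry f g h i) (fn f i) (fn g i) (fn h i)" if "\<not> n < i" for i
  proof -
    have i: "i < length l" using that l(2) by simp
    then have "ap_step (\<lambda>a b c. (a, b, c) \<in> set (take i l)) (fn f i) (fn g i) (fn h i)"
      using l(1) f(2) g(2) h(2) by (simp add: derivation_def)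
    then show ?thesis
    proof (rule ap_step_mono)
      fix a b c assume "(a, b, c) \<in> set (take i l)"
      then obtain j where "j < i" "j < length l" "l ! j = (a, b, c)"
        by (auto simp: in_set_conv_nth)
      then show "entry f g h i a b c"
        using f(2) g(2) h(2) by (intro exI[of _ j]) simp
    qed
  qed
  then have "\<forall>i. n < i \<or> ap_step (entry f g h i) (fn f i) (fn g i) (fn h i)" by blast
  moreover have "fn f n = a" "fn g n = b" "fn h n = c"
    using f(2) g(2) h(2) l by simp_all
  ultimately show ?R using f(1) g(1) h(1) by blast
next
  assume ?R
  then obtain f g h n where abc: "a = fn f n" "b = fn g n" "c = fn h n"
    and step: "\<And>i. \<not> n < i \<Longrightarrow> ap_step (entry f g h i) (fn f i) (fn g i) (fn h i)"
    by blast
  have "i \<le> n \<Longrightarrow> ap (fn f i) (fn g i) (fn h i)" for i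
  proof (induction i rule: less_induct)
    case (less i)
    have "ap_step (entry f g h i) (fn f i) (fn g i) (fn h i)"
      using step less.prems by simp
    then show ?case
    proof (rule ap_step_sound)
      fix a b c assume "entry f g h i a b c"
      then show "ap a b c" using less by auto
    qed
  qed
  then show "ap a b c" using abc by simp
qed


section \<open>Application is definable\<close>

primrec numT :: "nat \<Rightarrow> trm" where
  "numT 0 = CZero"
| "numT (Suc n) = CSuc \<cdot> numT n"

text \<open>
  The formulas below share one fixed stock of variables: 0 and 1 are \<open>x\<close> and \<open>y\<close>, 2 is the result
  of the application, 3 and 4 are indices of entries, 5 is the last index of the derivation,
  6 is bound inside \<open>LessF\<close>, and 7 to 10 are the existential variables of the rules.
\<close>

abbreviation fvar :: var where "fvar \<equiv> (0, TNat \<Rrightarrow> TNat)"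
abbreviation gvar :: var where "gvar \<equiv> (2, TNat \<Rrightarrow> TNat)"
abbreviation hvar :: var where "hvar \<equiv> (3, TNat \<Rrightarrow> TNat)"

definition plusT :: "trm \<Rightarrow> trm \<Rightarrow> trm" where
  "plusT s t = CRec [TNat] 0 \<cdot> s \<cdot> t \<cdot> Lam2 (nv 0) (nv 1) (CSuc \<cdot> Var (nv 0))"

definition LessF :: "var \<Rightarrow> var \<Rightarrow> fm" where
  "LessF v w = Exists (nv 6) (Eq (Var w) (plusT (Var (nv 6)) (CSuc \<cdot> Var v)))"

definition EntryF :: "trm \<Rightarrow> trm \<Rightarrow> trm \<Rightarrow> fm" where
  "EntryF p q r = Exists (nv 4) (Conj (LessF (nv 4) (nv 3)) (Conj (Eq p (Var fvar \<cdot> Var (nv 4)))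
     (Conj (Eq q (Var gvar \<cdot> Var (nv 4))) (Eq r (Var hvar \<cdot> Var (nv 4))))))"

abbreviation lftT :: "trm \<Rightarrow> trm" where "lftT t \<equiv> unpairT 0 \<cdot> t"
abbreviation rgtT :: "trm \<Rightarrow> trm" where "rgtT t \<equiv> unpairT (Suc 0) \<cdot> t"

definition StepF :: fm where
  "StepF = (let a = Var fvar \<cdot> Var (nv 3); b = Var gvar \<cdot> Var (nv 3); c = Var hvar \<cdot> Var (nv 3);
       m = Var (nv 7); w = Var (nv 8); u = Var (nv 9); v = Var (nv 10) in
     Disj (Conj (Eq (lftT a) (numT 0)) (Eq c (CSuc \<cdot> b)))
    (Disj (Conj (Eq (lftT a) (numT 2)) (Conj (Eq (lftT c) (numT 3))
       (Conj (Eq (lftT (rgtT c)) (rgtT a)) (Eq (rgtT (rgtT c)) b))))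
    (Disj (Conj (Eq (lftT a) (numT 3)) (Conj (Eq (lftT c) (lftT (rgtT a)))
       (Conj (Eq (lftT (rgtT c)) (rgtT (rgtT a))) (Eq (rgtT (rgtT c)) b))))
    (Disj (Conj (Eq (lftT a) (numT 4)) (Exists (nv 9) (Exists (nv 10)
       (Conj (EntryF (lftT (rgtT a)) b u) (Conj (EntryF (rgtT (rgtT a)) b v) (EntryF u v c))))))
    (Disj (Conj (Eq (lftT a) (numT 5)) (Conj (Eq (lftT (rgtT a)) (numT 0)) (Eq c (rgtT (rgtT a)))))
       (Conj (Eq (lftT a) (numT 5))
         (Exists (nv 7) (Exists (nv 8) (Exists (nv 9) (Exists (nv 10)
           (Conj (Eq (lftT (rgtT a)) (CSuc \<cdot> m)) (Conj (Eq (lftT w) (numT 5))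
           (Conj (Eq (lftT (rgtT w)) m) (Conj (Eq (rgtT (rgtT w)) (rgtT (rgtT a)))
           (Conj (EntryF w b u) (Conj (EntryF b u v) (EntryF v m c)))))))))))))))))"

definition SelfAppF :: fm where
  "SelfAppF = Exists fvar (Exists gvar (Exists hvar (Exists (nv 5)
     (Conj (Eq (Var fvar \<cdot> Var (nv 5)) (Var (nv 0)))
     (Conj (Eq (Var gvar \<cdot> Var (nv 5)) (Var (nv 0)))
     (Conj (Eq (Var hvar \<cdot> Var (nv 5)) (Var (nv 2)))
       (Forall (nv 3) (Disj (LessF (nv 5) (nv 3)) StepF))))))))"

text \<open>
  The diagonal formula $\varphi(x,y)$: if $\{x\}(x)$ is defined, then \<open>y\<close> is not a component of the
  sequence coded by it.
\<close>

definition DiagF :: fm where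
  "DiagF = Forall (nv 2) (Imp SelfAppF (Neg (InSeq (Var (nv 1)) (Var (nv 2)))))"

lemma fv_closed [simp]:
  "fv_trm (unpairT i) = {}" "fv_trm (numT k) = {}" "fv_trm (plusT s t) = fv_trm s \<union> fv_trm t"
proof -
  show "fv_trm (numT k) = {}" by (induction k) simp_all
qed (auto simp: unpairT_def Let_def ifzT_def predT_def plusT_def)

lemma types_closed:
  "type_of (unpairT 0) = Some (TNat \<Rrightarrow> TNat)" "type_of (unpairT (Suc 0)) = Some (TNat \<Rrightarrow> TNat)"
  "type_of (numT k) = Some TNat"
  "type_of s = Some TNat \<Longrightarrow> type_of t = Some TNat \<Longrightarrow> type_of (plusT s t) = Some TNat"
proof -
  show "type_of (numT k) = Some TNat" by (induction k) simp_all
qed (simp_all add: unpairT_def Let_def ifzT_def predT_def plusT_def)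

lemma wf_DiagF: "wf_fm DiagF"
  by (simp add: DiagF_def SelfAppF_def StepF_def EntryF_def LessF_def Let_def wf_InSeq
      has_type_def types_closed del: numT.simps)

lemma fv_LessF: "v \<noteq> nv 6 \<Longrightarrow> w \<noteq> nv 6 \<Longrightarrow> fv_fm (LessF v w) = {v, w}"
  by (auto simp: LessF_def)

lemma fv_EntryF: "nv 4 \<notin> fv_trm p \<union> fv_trm q \<union> fv_trm r \<Longrightarrow>
    fv_fm (EntryF p q r) = fv_trm p \<union> fv_trm q \<union> fv_trm r \<union> {nv 3, fvar, gvar, hvar}"
  by (auto simp: EntryF_def fv_LessF)

lemma fv_StepF: "fv_fm StepF = {nv 3, fvar, gvar, hvar}"
  by (auto simp: StepF_def Let_def fv_EntryF simp del: numT.simps)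

lemma fv_DiagF: "fv_fm DiagF = {nv 0, nv 1}"
  by (auto simp: DiagF_def SelfAppF_def fv_StepF fv_LessF fv_InSeq)

lemma den_numT [simp]: "dn e (numT k) = Some k"
  by (induction k) simp_all

lemma den_fn: "total (e v) \<Longrightarrow> dn e (Var v \<cdot> t) = map_option (fn (e v)) (dn e t)"
  by (rule den_App_total) (auto intro: ap_fn)

lemma den_plusT:
  assumes "dn e s = Some a" "dn e t = Some b"
  shows "dn e (plusT s t) = Some (a + b)"
proof -
  have "dn (e(nv 0 := c, nv 1 := d)) (CSuc \<cdot> Var (nv 0)) = Some (Suc c)" for c d
    by simp
  then obtain r where r: "dn e (Lam2 (nv 0) (nv 1) (CSuc \<cdot> Var (nv 0))) = Some r"
      "\<And>c d. aps r [c, d] (Suc c)"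
    by (rule den_Lam2[where F = "\<lambda>c _. Suc c"]) blast
  show ?thesis
    unfolding plusT_def
    by (rule den_rec[OF assms(1) _ r(1), of _ "\<lambda>n. n + b"]) (use assms r(2) in \<open>simp_all del: aps.simps\<close>)
qed

lemma sat_LessF: "v \<noteq> nv 6 \<Longrightarrow> w \<noteq> nv 6 \<Longrightarrow> sat e (LessF v w) \<longleftrightarrow> e v < e w"
proof -
  assume "v \<noteq> nv 6" "w \<noteq> nv 6"
  then have "sat e (LessF v w) \<longleftrightarrow> (\<exists>d. e w = d + Suc (e v))"
    by (simp add: LessF_def den_plusT)
  then show ?thesis by (metis less_iff_Suc_add add.commute add_Suc_right add_Suc)
qed

lemma sat_EntryF:
  assumes "total (e fvar)" "total (e gvar)" "total (e hvar)"
    and "nv 4 \<notin> fv_trm p" "nv 4 \<notin> fv_trm q" "nv 4 \<notin> fv_trm r"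
  shows "sat e (EntryF p q r) \<longleftrightarrow> (\<exists>j<e (nv 3). dn e p = Some (fn (e fvar) j) \<and>
    dn e q = Some (fn (e gvar) j) \<and> dn e r = Some (fn (e hvar) j))"
proof -
  have "dn (e(nv 4 := j)) s = dn e s" if "s \<in> {p, q, r}" for j s
    using that assms by (intro den_upd_fresh) auto
  then show ?thesis
    using assms(1-3) by (simp add: EntryF_def sat_LessF den_fn)
qed

text \<open>
  \<open>StepF\<close> was laid out clause by clause like \<open>ap_step\<close>, so that evaluating its terms turns one into
  the other.
\<close>

lemma sat_StepF:
  assumes "total (e fvar)" "total (e gvar)" "total (e hvar)"
  shows "sat e StepF \<longleftrightarrow> ap_step (entry (e fvar) (e gvar) (e hvar) (e (nv 3)))
    (fn (e fvar) (e (nv 3))) (fn (e gvar) (e (nv 3))) (fn (e hvar) (e (nv 3)))"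
  unfolding StepF_def ap_step_def Let_def
  by (simp add: sat_EntryF den_fn assms del: numT.simps)

lemma sat_SelfAppF: "sat e SelfAppF \<longleftrightarrow> ap (e (nv 0)) (e (nv 0)) (e (nv 2))"
  unfolding SelfAppF_def ap_iff_tables
  by (simp add: sat_StepF sat_LessF den_fn per_type_1 del: per.simps(2) cong: conj_cong)

lemma sat_DiagF: "sat e DiagF \<longleftrightarrow> (\<forall>z. ap (e (nv 0)) (e (nv 0)) z \<longrightarrow> e (nv 1) \<notin> members z)"
proof -
  have "sat (e(nv 2 := z)) (InSeq (Var (nv 1)) (Var (nv 2))) \<longleftrightarrow> e (nv 1) \<in> members z" for z
    by (rule sat_InSeq) simp_all
  then show ?thesis by (simp add: DiagF_def sat_SelfAppF)
qed

theorem lemma3p1: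
  shows "\<exists>x y \<phi>. snd x = TNat \<and> snd y = TNat \<and> x \<noteq> y \<and> wf_fm \<phi> \<and> fv_fm \<phi> = {x, y} \<and>
    (\<forall>f. snd f = TFun TNat TNat \<longrightarrow>
      \<not> EPA (Imp (Forall x (Exists y \<phi>))
               (Exists f (Forall x (Exists y (Conj (InSeq (Var y) (App (Var f) (Var x))) \<phi>))))))"
proof (intro exI HOL.conjI allI impI notI)
  fix f :: var
  assume f: "snd f = TNat \<Rrightarrow> TNat"
  assume "EPA (Imp (Forall (nv 0) (Exists (nv 1) DiagF))
    (Exists f (Forall (nv 0) (Exists (nv 1) (Conj (InSeq (Var (nv 1)) (Var f \<cdot> Var (nv 0))) DiagF)))))"
  moreover obtain e where "adequate e" using adequate_exists by blast
  ultimately have sat: "sat e (Imp (Forall (nv 0) (Exists (nv 1) DiagF))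
    (Exists f (Forall (nv 0) (Exists (nv 1) (Conj (InSeq (Var (nv 1)) (Var f \<cdot> Var (nv 0))) DiagF)))))"
    by (rule soundness)
  \<comment> \<open>A finite sequence omits some number.\<close>
  have "\<exists>y. \<forall>z. ap x x z \<longrightarrow> y \<notin> members z" for x
  proof (cases "\<exists>z. ap x x z")
    case True
    then obtain z where z: "ap x x z" by blast
    obtain y where "y \<notin> members z"
      using ex_new_if_finite[OF infinite_UNIV_nat finite_members] by blast
    with z show ?thesis using ap_deterministic by blast
  qed blast
  then have "sat e (Forall (nv 0) (Exists (nv 1) DiagF))"
    by (simp add: sat_DiagF)
  with sat obtain a where a: "total a"
    "sat (e(f := a)) (Forall (nv 0) (Exists (nv 1) (Conj (InSeq (Var (nv 1)) (Var f \<cdot> Var (nv 0))) DiagF)))"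
    using f by (auto simp: per_type_1 simp del: per.simps(2))
  \<comment> \<open>A code of the function is a number: the diagonal argument is this code itself.\<close>
  then obtain y where y:
    "sat (e(f := a, nv 0 := a, nv 1 := y)) (InSeq (Var (nv 1)) (Var f \<cdot> Var (nv 0)))"
    "sat (e(f := a, nv 0 := a, nv 1 := y)) DiagF"
    by auto
  have "f \<noteq> nv 0" "f \<noteq> nv 1" using f by auto
  then have "dn (e(f := a, nv 0 := a, nv 1 := y)) (Var f \<cdot> Var (nv 0)) = Some (fn a a)"
    using a(1) by (simp add: den_fn)
  then have "y \<in> members (fn a a)"
    using y(1) sat_InSeq[of "e(f := a, nv 0 := a, nv 1 := y)" "Var (nv 1)" y] by simp
  moreover have "y \<notin> members (fn a a)"
    using y(2) ap_fn[OF a(1)] by (simp add: sat_DiagF)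
  ultimately show False by blast
qed (simp_all add: wf_DiagF fv_DiagF)

end
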